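(* Let $h\geq 2$ be an integer, let $m_0=2h(2h-1)$, $m_1=(2h+1)(2h-1)$, $m_2=2h(2h+1)$, $m_3=2h(2h+1)+(2h-1)$, let $\Gamma_h=\langle m_0,m_1,m_2,m_3\rangle$, let $K$ be a field and let $R=K[[t^{m_0},t^{m_1},t^{m_2},t^{m_3}]]$ with maximal ideal $\mathfrak{m}$. Then the tangent cone $G_{\mathfrak{m}}(\Gamma_h)$ is Cohen–Macaulay.
   Context: The tangent cone is the associated graded ring $G_{\mathfrak{m}}(\Gamma_h)=\bigoplus_{n\geq 0}\mathfrak{m}^n/\mathfrak{m}^{n+1}$ of $R$. *)

theory Defs
  imports
    "HOL-Library.Extended_Nat"
    "HOL-Computational_Algebra.Formal_Power_Series"
    "HOL-Algebra.Ring_Divisibility"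
    "HOL-Algebra.Ideal_Product"
begin

text \<open>
  \<open>monomial_series_ring [m\<^sub>0, \<dots>, m\<^sub>r]\<close> is \<open>K[[t^m\<^sub>0, \<dots>, t^m\<^sub>r]]\<close> inside \<open>K[[t]]\<close>: its elements
  are the series \<open>\<Sum>\<^sub>a c\<^sub>a (t^m\<^sub>0)^a\<^sub>0 \<dots> (t^m\<^sub>r)^a\<^sub>r\<close> over all exponent vectors \<open>a\<close>, with arbitrary
  coefficients \<open>c\<^sub>a\<close>. This is meant for positive exponents, where only finitely many \<open>a\<close>
  contribute to each power of \<open>t\<close>.
\<close>

definition weight :: "nat list \<Rightarrow> nat list \<Rightarrow> nat" where
  "weight ms a = (\<Sum>i<length ms. a ! i * ms ! i)"

definition monomial_series_ring :: "nat list \<Rightarrow> 'k::field fps ring" where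
  "monomial_series_ring ms =
     \<lparr>carrier = {f. \<exists>c. \<forall>n. fps_nth f n = (\<Sum>a | length a = length ms \<and> weight ms a = n. c a)},
      mult = (*), one = 1, zero = 0, add = (+)\<rparr>"

definition numerical_semigroup :: "nat list \<Rightarrow> nat set" where
  "numerical_semigroup ms = {weight ms a | a. length a = length ms}"

lemma finite_weight:
  assumes "\<forall>m\<in>set ms. 0 < m"
  shows "finite {a. length a = length ms \<and> weight ms a = n}"
proof (rule finite_subset)
  show "finite {a. set a \<subseteq> {..n} \<and> length a = length ms}"
    by (rule finite_lists_length_eq) simp
  have "x \<le> weight ms a" if a: "length a = length ms" "x \<in> set a" for a x
  proof -
    from a obtain i where i: "i < length ms" "x = a ! i" by (metis in_set_conv_nth)
    have "x \<le> a ! i * ms ! i" using assms i by (simp add: Suc_leI)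
    also have "\<dots> \<le> weight ms a" unfolding weight_def using i by (intro member_le_sum) auto
    finally show ?thesis .
  qed
  then show "{a. length a = length ms \<and> weight ms a = n} \<subseteq> {a. set a \<subseteq> {..n} \<and> length a = length ms}"
    by auto
qed

lemma carrier_monomial_series_ring:
  assumes "\<forall>m\<in>set ms. 0 < m"
  shows "carrier (monomial_series_ring ms) = {f. \<forall>n. fps_nth f n \<noteq> 0 \<longrightarrow> n \<in> numerical_semigroup ms}"
proof (intro subset_antisym subsetI)
  fix f :: "'a fps" assume "f \<in> carrier (monomial_series_ring ms)"
  then obtain c where c: "\<And>n. fps_nth f n = (\<Sum>a | length a = length ms \<and> weight ms a = n. c a)"
    by (auto simp: monomial_series_ring_def)
  have "n \<in> numerical_semigroup ms" if "fps_nth f n \<noteq> 0" for n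
  proof (rule ccontr)
    assume "n \<notin> numerical_semigroup ms"
    then have "{a. length a = length ms \<and> weight ms a = n} = {}" by (auto simp: numerical_semigroup_def)
    then show False using that unfolding c by (metis sum.empty)
  qed
  then show "f \<in> {f. \<forall>n. fps_nth f n \<noteq> 0 \<longrightarrow> n \<in> numerical_semigroup ms}" by blast
next
  fix f :: "'a fps" assume f: "f \<in> {f. \<forall>n. fps_nth f n \<noteq> 0 \<longrightarrow> n \<in> numerical_semigroup ms}"
  define A where "A n = {a. length a = length ms \<and> weight ms a = n}" for n
  define r where "r n = (SOME a. a \<in> A n)" for n
  define c where "c a = (if a = r (weight ms a) then fps_nth f (weight ms a) else 0)" for a
  have "fps_nth f n = sum c (A n)" for n
  proof (cases "fps_nth f n = 0")
    case True
    then have "sum c (A n) = 0" by (intro sum.neutral) (auto simp: c_def A_def)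
    then show ?thesis using True by simp
  next
    case False
    then have "r n \<in> A n" using f unfolding r_def
      by (intro someI_ex[of "\<lambda>a. a \<in> A n"]) (auto simp: numerical_semigroup_def A_def)
    moreover have "sum c (A n) = (\<Sum>a\<in>A n. if a = r n then fps_nth f n else 0)"
      by (rule sum.cong) (auto simp: c_def A_def)
    moreover have "finite (A n)" unfolding A_def by (rule finite_weight[OF assms])
    ultimately show ?thesis by simp
  qed
  then show "f \<in> carrier (monomial_series_ring ms)" 
    by (auto simp: monomial_series_ring_def A_def)
qed

abbreviation ideal_power :: "('a, 'b) ring_scheme \<Rightarrow> 'a set \<Rightarrow> nat \<Rightarrow> 'a set" where
  "ideal_power R I n \<equiv> I [^]\<^bsub>ideals_set R\<^esub> n"

text \<open>
  An element of \<open>\<Oplus>\<^sub>n I^n/I^(n+1)\<close> is the family of its homogeneous components, each of them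
  a coset of \<open>I^(n+1)\<close> in \<open>I^n\<close>, almost all of them zero. The product is induced by
  \<open>(x + I^(i+1)) (y + I^(j+1)) = x y + I^(i+j+1)\<close>; as for \<open>R Quot I\<close>, it is written as a
  union over all choices of representatives.
\<close>

definition assoc_graded :: "('a, 'b) ring_scheme \<Rightarrow> 'a set \<Rightarrow> (nat \<Rightarrow> 'a set) ring" where
  "assoc_graded R I =
     \<lparr>carrier = {f. (\<forall>n. f n \<in> (\<lambda>x. ideal_power R I (Suc n) +>\<^bsub>R\<^esub> x) ` ideal_power R I n) \<and>
                    finite {n. f n \<noteq> ideal_power R I (Suc n)}},
      mult = (\<lambda>f g n. \<Union>a\<in>{a. \<forall>i. a i \<in> f i}. \<Union>b\<in>{b. \<forall>i. b i \<in> g i}.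
                ideal_power R I (Suc n) +>\<^bsub>R\<^esub> (\<Oplus>\<^bsub>R\<^esub>i\<in>{..n}. a i \<otimes>\<^bsub>R\<^esub> b (n - i))),
      one = (\<lambda>n. ideal_power R I (Suc n) +>\<^bsub>R\<^esub> (if n = 0 then \<one>\<^bsub>R\<^esub> else \<zero>\<^bsub>R\<^esub>)),
      zero = (\<lambda>n. ideal_power R I (Suc n)),
      add = (\<lambda>f g n. f n <+>\<^bsub>R\<^esub> g n)\<rparr>"

text \<open>
  \<open>localization R S\<close> is \<open>S\<inverse>R\<close> for a multiplicatively closed \<open>S\<close> containing \<open>\<one>\<close>;
  \<open>ring_frac R S a s\<close> is the fraction \<open>a/s\<close>. No cancellation in \<open>R\<close> is assumed.
\<close>

definition frac_rel :: "('a, 'b) ring_scheme \<Rightarrow> 'a set \<Rightarrow> (('a \<times> 'a) \<times> ('a \<times> 'a)) set" where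
  "frac_rel R S =
     {((a, s), (b, t)). a \<in> carrier R \<and> s \<in> S \<and> b \<in> carrier R \<and> t \<in> S \<and>
        (\<exists>u\<in>S. u \<otimes>\<^bsub>R\<^esub> (a \<otimes>\<^bsub>R\<^esub> t) = u \<otimes>\<^bsub>R\<^esub> (b \<otimes>\<^bsub>R\<^esub> s))}"

definition ring_frac :: "('a, 'b) ring_scheme \<Rightarrow> 'a set \<Rightarrow> 'a \<Rightarrow> 'a \<Rightarrow> ('a \<times> 'a) set" where
  "ring_frac R S a s = frac_rel R S `` {(a, s)}"

definition localization :: "('a, 'b) ring_scheme \<Rightarrow> 'a set \<Rightarrow> ('a \<times> 'a) set ring" where
  "localization R S =
     \<lparr>carrier = (carrier R \<times> S) // frac_rel R S,
      mult = (\<lambda>X Y. \<Union>(a, s)\<in>X. \<Union>(b, t)\<in>Y. ring_frac R S (a \<otimes>\<^bsub>R\<^esub> b) (s \<otimes>\<^bsub>R\<^esub> t)),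
      one = ring_frac R S \<one>\<^bsub>R\<^esub> \<one>\<^bsub>R\<^esub>,
      zero = ring_frac R S \<zero>\<^bsub>R\<^esub> \<one>\<^bsub>R\<^esub>,
      add = (\<lambda>X Y. \<Union>(a, s)\<in>X. \<Union>(b, t)\<in>Y.
               ring_frac R S (a \<otimes>\<^bsub>R\<^esub> t \<oplus>\<^bsub>R\<^esub> b \<otimes>\<^bsub>R\<^esub> s) (s \<otimes>\<^bsub>R\<^esub> t))\<rparr>"

definition krull_dim :: "('a, 'b) ring_scheme \<Rightarrow> enat" where
  "krull_dim R =
     (SUP Ps\<in>{Ps. Ps \<noteq> [] \<and> (\<forall>P\<in>set Ps. primeideal P R) \<and> sorted_wrt (\<subset>) Ps}.
        enat (length Ps - 1))"

definition nonzerodivisor :: "('a, 'b) ring_scheme \<Rightarrow> 'a \<Rightarrow> bool" where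
  "nonzerodivisor R x \<longleftrightarrow>
     x \<in> carrier R \<and> (\<forall>y\<in>carrier R. x \<otimes>\<^bsub>R\<^esub> y = \<zero>\<^bsub>R\<^esub> \<longrightarrow> y = \<zero>\<^bsub>R\<^esub>)"

definition regular_sequence :: "('a, 'b) ring_scheme \<Rightarrow> 'a list \<Rightarrow> bool" where
  "regular_sequence R xs \<longleftrightarrow>
     set xs \<subseteq> carrier R \<and> Idl\<^bsub>R\<^esub> (set xs) \<noteq> carrier R \<and>
     (\<forall>i<length xs. let J = Idl\<^bsub>R\<^esub> (set (take i xs)) in nonzerodivisor (R Quot J) (J +>\<^bsub>R\<^esub> xs ! i))"

definition depth :: "('a, 'b) ring_scheme \<Rightarrow> 'a set \<Rightarrow> enat" where
  "depth R I = (SUP xs\<in>{xs. regular_sequence R xs \<and> set xs \<subseteq> I}. enat (length xs))"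

definition cohen_macaulay_local :: "('a, 'b) ring_scheme \<Rightarrow> bool" where
  "cohen_macaulay_local A \<longleftrightarrow>
     cring A \<and> noetherian_ring A \<and>
     (\<exists>N. maximalideal N A \<and> (\<forall>N'. maximalideal N' A \<longrightarrow> N' = N) \<and> depth A N = krull_dim A)"

definition cohen_macaulay :: "('a, 'b) ring_scheme \<Rightarrow> bool" where
  "cohen_macaulay R \<longleftrightarrow>
     cring R \<and> noetherian_ring R \<and>
     (\<forall>M. maximalideal M R \<longrightarrow> cohen_macaulay_local (localization R (carrier R - M)))"

end

theory Submission
  imports Defs "HOL-Computational_Algebra.Polynomial"
begin

text \<open>
  Give a power \<open>t^s\<close> in \<open>R\<close> the order \<open>ord s\<close>, the largest number of generators in a factorization of
  \<open>s\<close>. Then \<open>\<mm>^n\<close> consists of the series whose exponents have order at least \<open>n\<close>, and the tangent cone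
  has a basis \<open>e\<^sub>s\<close> with \<open>e\<^sub>s e\<^sub>t = e\<^bsub>s+t\<^esub>\<close> if \<open>ord s + ord t = ord (s + t)\<close> and \<open>e\<^sub>s e\<^sub>t = 0\<close> otherwise.

  With \<open>p = 2h\<close> the relations \<open>x\<^sub>1x\<^sub>2 = x\<^sub>0x\<^sub>3\<close>, \<open>x\<^sub>1^j x\<^sub>3^k = x\<^sub>0^(j+1) x\<^sub>2^k\<close> for \<open>j + k = p\<close> and
  \<open>x\<^sub>2^j x\<^sub>3^k = x\<^sub>0^(j+2) x\<^sub>1^k\<close> for \<open>j + k = p - 1\<close> never shorten a monomial when read from left to
  right. The monomials without \<open>x\<^sub>0\<close> to which none applies have distinct weights modulo \<open>m\<^sub>0 = p(p - 1)\<close>,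
  so they are the Apery set of \<open>m\<^sub>0\<close>, and \<open>ord (s + m\<^sub>0) = ord s + 1\<close> follows. Hence the tangent
  cone is a finite torsion-free algebra over \<open>K[X]\<close>, where \<open>X\<close> acts as \<open>e\<^bsub>m0\<^esub>\<close>.

  A finite torsion-free algebra over a Euclidean ring \<open>P\<close> that is not a field is Noetherian and
  integral over \<open>P\<close>. A maximal ideal \<open>M\<close> contracts to some \<open>(f) \<noteq> 0\<close>, and \<open>f\<close> is a nonzerodivisor.
  Cutting monic relations at the first coefficient outside \<open>(f)\<close>, or outside \<open>0\<close>, shows that in the
  localization at \<open>M\<close> every element of the maximal ideal has a power divisible by \<open>f\<close>, and that every
  \<open>g\<close> satisfies \<open>f^k g^i \<in> (g^(i+1))\<close>. These two facts force depth and dimension to be one.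
\<close>

section \<open>Local rings of depth and dimension one\<close>

text \<open>Membership in \<open>J\<close> replaces equality of cosets; the conditions in
  \<open>regular_sequence\<close> are used in this form only.\<close>

lemma (in cring) nonzerodivisor_quot_iff:
  assumes "ideal J R" "x \<in> carrier R"
  shows "nonzerodivisor (R Quot J) (J +> x) \<longleftrightarrow> (\<forall>z\<in>carrier R. x \<otimes> z \<in> J \<longrightarrow> z \<in> J)"
proof -
  interpret ideal J R by fact
  have zero: "J +> z = J \<longleftrightarrow> z \<in> J" if "z \<in> carrier R" for z
    using that by (metis a_coset_join2 additive_subgroup.a_subgroup is_additive_subgroup rcos_const_imp_mem)
  have "J +> x \<in> carrier (R Quot J)"
    using assms by (auto simp: FactRing_def A_RCOSETS_def')
  then have "nonzerodivisor (R Quot J) (J +> x) \<longleftrightarrow>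
      (\<forall>z\<in>carrier R. [mod J:] (J +> x) \<Otimes> (J +> z) = J \<longrightarrow> J +> z = J)"
    by (auto simp: nonzerodivisor_def FactRing_def A_RCOSETS_def')
  then show ?thesis
    using assms by (simp add: rcoset_mult_add zero)
qed

lemma (in ring) genideal_empty: "Idl {} = {\<zero>}"
proof
  show "Idl {} \<subseteq> {\<zero>}" by (rule genideal_minimal[OF zeroideal]) simp
  interpret ideal "Idl {}" R by (rule genideal_ideal) simp
  show "{\<zero>} \<subseteq> Idl {}" using zero_closed by simp
qed

lemma (in cring) genideal_singleton_iff:
  assumes "x \<in> carrier R"
  shows "z \<in> Idl {x} \<longleftrightarrow> (\<exists>w\<in>carrier R. z = x \<otimes> w)"
  using assms by (auto simp flip: cgenideal_eq_genideal simp: cgenideal_def m_comm)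

lemma (in cring) primeideal_nat_pow:
  assumes "primeideal P R" "g \<in> carrier R" "g [^] (n::nat) \<in> P"
  shows "g \<in> P"
proof -
  interpret P: primeideal P R by fact
  show ?thesis
    using assms(3)
  proof (induction n)
    case 0
    then show ?case using P.one_imp_carrier P.I_notcarr by simp
  next
    case (Suc n)
    then show ?case using P.I_prime[of "g [^] n" g] assms(2) by auto
  qed
qed

lemma (in cring) mult_minus_eq_zero:
  assumes "a \<in> carrier R" "u \<in> carrier R" "v \<in> carrier R" "u \<otimes> a = a \<otimes> v"
  shows "a \<otimes> (u \<ominus> v) = \<zero>"
  using assms by (simp add: a_minus_def r_distr r_minus m_comm r_neg)

lemma (in cring) ideal_add_cgenideal:
  assumes "ideal I R" "a \<in> carrier R"
  shows in_add_cgenideal_iff: "x \<in> I <+>\<^bsub>R\<^esub> PIdl a \<longleftrightarrow> (\<exists>q\<in>I. \<exists>w\<in>carrier R. x = q \<oplus> w \<otimes> a)"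
    and ideal_add_cgenideal_ideal: "ideal (I <+>\<^bsub>R\<^esub> PIdl a) R"
    and ideal_add_cgenideal_subset: "I \<subseteq> I <+>\<^bsub>R\<^esub> PIdl a"
    and ideal_add_cgenideal_self: "a \<in> I <+>\<^bsub>R\<^esub> PIdl a"
proof -
  interpret I: ideal I R by fact
  show iff: "x \<in> I <+>\<^bsub>R\<^esub> PIdl a \<longleftrightarrow> (\<exists>q\<in>I. \<exists>w\<in>carrier R. x = q \<oplus> w \<otimes> a)" for x
    unfolding set_add_def' cgenideal_def by blast
  show "ideal (I <+>\<^bsub>R\<^esub> PIdl a) R"
    by (rule add_ideals[OF assms(1) cgenideal_ideal[OF assms(2)]])
  have "q = q \<oplus> \<zero> \<otimes> a" if "q \<in> I" for q using that assms I.Icarr by simp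
  then show "I \<subseteq> I <+>\<^bsub>R\<^esub> PIdl a" using iff by blast
  have "a = \<zero> \<oplus> \<one> \<otimes> a" using assms by simp
  then show "a \<in> I <+>\<^bsub>R\<^esub> PIdl a" using iff I.zero_closed by blast
qed

lemma (in cring) maximalideal_one_decomp:
  assumes "maximalideal I R" "a \<in> carrier R" "a \<notin> I"
  shows "\<exists>q\<in>I. \<exists>w\<in>carrier R. \<one> = q \<oplus> w \<otimes> a"
proof -
  interpret I: maximalideal I R by fact
  note X = ideal_add_cgenideal[OF I.is_ideal assms(2)]
  have "I <+>\<^bsub>R\<^esub> PIdl a = carrier R"
    using I.I_maximal[OF X(2,3)] additive_subgroup.a_subset[OF ideal.axioms(1)[OF X(2)]] X(4) assms(3)
    by auto
  then show ?thesis using X(1)[of \<one>] by simp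
qed

text \<open>By Zorn's lemma there is an ideal \<open>Q\<close> maximal among those containing no
  power of \<open>y\<close>. It is prime: for \<open>a\<close> and \<open>b\<close> outside
  \<open>Q\<close> some powers of \<open>y\<close> lie in \<open>Q + (a)\<close> and in
  \<open>Q + (b)\<close>, so their product lies in \<open>Q + (a b)\<close>, which would be
  \<open>Q\<close> if \<open>a b\<close> were in \<open>Q\<close>.\<close>

lemma (in cring) exists_prime_avoiding:
  assumes y: "y \<in> carrier R" and not_nilpotent: "\<And>n::nat. y [^] n \<noteq> \<zero>"
  shows "\<exists>Q. primeideal Q R \<and> y \<notin> Q"
proof -
  define S where "S = {I. ideal I R \<and> (\<forall>n::nat. y [^] n \<notin> I)}"
  have "\<exists>M \<in> S. \<forall>X \<in> S. M \<subseteq> X \<longrightarrow> X = M"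
  proof (rule subset_Zorn)
    fix C assume C: "subset.chain S C"
    show "\<exists>U \<in> S. \<forall>X \<in> C. X \<subseteq> U"
    proof (cases "C = {}")
      case True
      have "{\<zero>} \<in> S" using zeroideal not_nilpotent by (auto simp: S_def)
      then show ?thesis using True by auto
    next
      case False
      have "subset.chain {I. ideal I R} C"
        using C by (auto simp: S_def pred_on.chain_def)
      from chain_Union_is_ideal[OF this] False have "\<Union>C \<in> S"
        using C by (auto simp: S_def pred_on.chain_def)
      then show ?thesis by blast
    qed
  qed
  then obtain Q where Q: "Q \<in> S" and max: "\<And>X. X \<in> S \<Longrightarrow> Q \<subseteq> X \<Longrightarrow> X = Q" by auto
  interpret Q: ideal Q R using Q by (simp add: S_def)
  have nQ: "y [^] n \<notin> Q" for n :: nat using Q by (simp add: S_def)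
  have step: "\<exists>n::nat. \<exists>q\<in>Q. \<exists>w\<in>carrier R. y [^] n = q \<oplus> w \<otimes> a" if a: "a \<in> carrier R" "a \<notin> Q" for a
  proof -
    note X = ideal_add_cgenideal[OF Q.is_ideal a(1)]
    have "Q <+>\<^bsub>R\<^esub> PIdl a \<notin> S" using max[OF _ X(3)] X(4) a(2) by auto
    then show ?thesis using X(1,2) by (auto simp: S_def)
  qed
  have "primeideal Q R"
  proof (rule primeidealI[OF Q.is_ideal is_cring])
    show "carrier R \<noteq> Q" using nQ[of 0] by auto
    fix a b assume ab: "a \<in> carrier R" "b \<in> carrier R" "a \<otimes> b \<in> Q"
    show "a \<in> Q \<or> b \<in> Q"
    proof (rule ccontr)
      assume "\<not> (a \<in> Q \<or> b \<in> Q)"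
      then obtain n m :: nat and p q u v where *: "p \<in> Q" "q \<in> Q" "u \<in> carrier R" "v \<in> carrier R"
        "y [^] n = p \<oplus> u \<otimes> a" "y [^] m = q \<oplus> v \<otimes> b"
        using step ab by meson
      have pq: "p \<in> carrier R" "q \<in> carrier R" using * Q.Icarr by auto
      have "y [^] (n + m) = (p \<oplus> u \<otimes> a) \<otimes> (q \<oplus> v \<otimes> b)"
        using * y by (simp flip: nat_pow_mult)
      also have "\<dots> = p \<otimes> (q \<oplus> v \<otimes> b) \<oplus> (u \<otimes> a) \<otimes> q \<oplus> (u \<otimes> v) \<otimes> (a \<otimes> b)"
        using * pq ab(1,2) by algebra
      also have "\<dots> \<in> Q"
        using * pq ab
        by (intro Q.a_closed Q.I_r_closed[of p] Q.I_l_closed[of q] Q.I_l_closed[of "a \<otimes> b"]) auto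
      finally show False using nQ by blast
    qed
  qed
  then show ?thesis using nQ[of 1] y by auto
qed

section \<open>Depth and dimension from a single parameter\<close>

context cring
begin

text \<open>Here \<open>y\<close> plays the role of a parameter. \<open>power_in\<close> puts
  \<open>N\<close> into the radical of \<open>(y)\<close>. \<open>power_relation\<close> puts a
  power of \<open>y\<close> into \<open>(g)\<close> up to the factor \<open>g [^] i\<close>, which
  can be cancelled modulo a prime that avoids \<open>g\<close>, or when \<open>g\<close> is a
  nonzerodivisor.\<close>

context
  fixes N y
  assumes N: "maximalideal N R"
    and yN: "y \<in> N"
    and regular: "\<And>z. z \<in> carrier R \<Longrightarrow> y \<otimes> z = \<zero> \<Longrightarrow> z = \<zero>"
    and local: "\<And>P. primeideal P R \<Longrightarrow> P \<subseteq> N"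
    and power_in: "\<And>g. g \<in> N \<Longrightarrow> \<exists>i::nat. \<exists>z\<in>carrier R. g [^] i = y \<otimes> z"
    and power_relation: "\<And>g. g \<in> carrier R \<Longrightarrow>
      \<exists>(i::nat) (k::nat). \<exists>z\<in>carrier R. y [^] k \<otimes> g [^] i = g [^] i \<otimes> (g \<otimes> z)"
begin

interpretation N: maximalideal N R by (rule N)

lemma parameter_closed: "y \<in> carrier R"
  using yN N.Icarr by auto

text \<open>Each element of \<open>N\<close> has a power in \<open>(y)\<close>, hence in
  \<open>P\<close>, and so lies in the prime \<open>P\<close>; maximality of \<open>N\<close> does
  the rest.\<close>

lemma prime_containing_parameter:
  assumes P: "primeideal P R" and "y \<in> P"
  shows "P = N"
proof -
  interpret P: primeideal P R by (rule P)
  have "N \<subseteq> P"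
  proof
    fix g assume g: "g \<in> N"
    then obtain i :: nat and z where "z \<in> carrier R" "g [^] i = y \<otimes> z" using power_in by blast
    then have "g [^] i \<in> P" using \<open>y \<in> P\<close> by (simp add: P.I_r_closed)
    then show "g \<in> P" using primeideal_nat_pow[OF P N.Icarr[OF g]] by blast
  qed
  then show ?thesis
    using N.I_maximal[OF P.is_ideal] P.a_subset P.I_notcarr by auto
qed

text \<open>In a chain of three primes the lower two are not \<open>N\<close>, so they avoid
  \<open>y\<close>. For \<open>g\<close> in \<open>P1\<close> but not in \<open>P0\<close>,
  cancelling \<open>g [^] i\<close> modulo \<open>P0\<close> in the power relation puts a power of
  \<open>y\<close> into \<open>P1\<close>, a contradiction. Conversely \<open>y\<close> is not
  nilpotent, being a nonzerodivisor, so some prime avoids it and lies strictly below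
  \<open>N\<close>.\<close>

lemma krull_dim_eq_1: "krull_dim R = 1"
proof (rule antisym)
  show "krull_dim R \<le> 1"
    unfolding krull_dim_def
  proof (rule SUP_least)
    fix Ps assume Ps: "Ps \<in> {Ps. Ps \<noteq> [] \<and> (\<forall>P\<in>set Ps. primeideal P R) \<and> sorted_wrt (\<subset>) Ps}"
    have "length Ps \<le> 2"
    proof (rule ccontr)
      assume "\<not> length Ps \<le> 2"
      then obtain P0 P1 P2 Qs where "Ps = P0 # P1 # P2 # Qs"
        by (auto simp: not_le numeral_2_eq_2 less_eq_Suc_le Suc_le_length_iff)
      with Ps have P: "primeideal P0 R" "primeideal P1 R" "primeideal P2 R" "P0 \<subset> P1" "P1 \<subset> P2"
        by auto
      interpret P0: primeideal P0 R by fact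
      interpret P1: primeideal P1 R by fact
      interpret P2: primeideal P2 R by fact
      have not_max: "P \<noteq> N" if "ideal P' R" "P \<subset> P'" "P' \<noteq> carrier R" for P P'
        using that N.I_maximal[of P'] additive_subgroup.a_subset[OF ideal.axioms(1)[OF that(1)]] by auto
      have y0: "y \<notin> P0" and y1: "y \<notin> P1"
        using prime_containing_parameter P not_max P1.is_ideal P2.is_ideal P1.I_notcarr P2.I_notcarr
        by metis+
      obtain g where g: "g \<in> P1" "g \<notin> P0" using P by auto
      then have gc: "g \<in> carrier R" using P1.Icarr by auto
      obtain i k :: nat and z where z: "z \<in> carrier R" "y [^] k \<otimes> g [^] i = g [^] i \<otimes> (g \<otimes> z)"
        using power_relation[OF gc] by blast
      have "g [^] i \<otimes> (y [^] k \<ominus> g \<otimes> z) = \<zero>"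
        using z gc parameter_closed by (intro mult_minus_eq_zero) auto
      then have "g [^] i \<otimes> (y [^] k \<ominus> g \<otimes> z) \<in> P0" using P0.zero_closed by simp
      then have "y [^] k \<ominus> g \<otimes> z \<in> P0"
        using P0.I_prime z gc parameter_closed g(2) primeideal_nat_pow[OF P(1) gc]
        by (metis m_closed minus_closed nat_pow_closed)
      then have "y [^] k \<ominus> g \<otimes> z \<in> P1" using P(4) by auto
      then have "(y [^] k \<ominus> g \<otimes> z) \<oplus> g \<otimes> z \<in> P1"
        by (rule P1.a_closed) (rule P1.I_r_closed[OF g(1) z(1)])
      then have "y [^] k \<in> P1"
        using z(1) gc parameter_closed by (simp add: a_minus_def a_assoc l_neg)
      then show False using primeideal_nat_pow[OF P(2) parameter_closed] y1 by blast
    qed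
    then show "enat (length Ps - 1) \<le> 1" by (simp add: one_enat_def)
  qed
next
  have "y [^] n \<noteq> \<zero>" for n :: nat
  proof (induction n)
    case 0
    show ?case
    proof
      assume "y [^] (0::nat) = \<zero>"
      then have "\<one> \<in> N" using N.zero_closed by simp
      then show False using N.one_imp_carrier N.I_notcarr by simp
    qed
  next
    case (Suc n)
    have "y [^] Suc n = y \<otimes> y [^] n" using parameter_closed by (simp add: m_comm)
    then show ?case using regular[of "y [^] n"] parameter_closed Suc by (metis nat_pow_closed)
  qed
  then obtain Q where Q: "primeideal Q R" "y \<notin> Q"
    using exists_prime_avoiding[OF parameter_closed] by blast
  interpret Q: primeideal Q R by (rule Q)
  have "Q \<subset> N" using local[OF Q(1)] Q yN by auto
  then have "[Q, N] \<in> {Ps. Ps \<noteq> [] \<and> (\<forall>P\<in>set Ps. primeideal P R) \<and> sorted_wrt (\<subset>) Ps}"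
    using Q maximalideal_prime[OF N] by auto
  then have "enat (length [Q, N] - 1) \<le> krull_dim R"
    unfolding krull_dim_def by (rule SUP_upper)
  then show "1 \<le> krull_dim R" by (simp add: one_enat_def)
qed

text \<open>If a regular sequence began with \<open>x1, x2\<close>, cancelling
  \<open>x1 [^] i\<close> in the power relation would give a power of \<open>y\<close> in
  \<open>(x1)\<close>. Since a power of \<open>x2\<close> lies in \<open>(y)\<close>, a power of
  \<open>x2\<close> would lie in \<open>(x1)\<close>; cancelling \<open>x2\<close> modulo
  \<open>(x1)\<close> would leave \<open>\<one>\<close> there. The sequence \<open>[y]\<close> gives
  the lower bound.\<close>

lemma depth_eq_1: "depth R N = 1"
proof (rule antisym)
  show "depth R N \<le> 1"
    unfolding depth_def
  proof (rule SUP_least)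
    fix xs assume xs: "xs \<in> {xs. regular_sequence R xs \<and> set xs \<subseteq> N}"
    have "length xs \<le> 1"
    proof (rule ccontr)
      assume "\<not> length xs \<le> 1"
      then obtain x1 x2 ys where eq: "xs = x1 # x2 # ys"
        by (auto simp: not_le less_eq_Suc_le Suc_le_length_iff)
      have c: "x1 \<in> carrier R" "x2 \<in> carrier R" "x2 \<in> N" and proper: "Idl (set xs) \<noteq> carrier R"
        using xs unfolding regular_sequence_def eq by auto
      have nzd: "nonzerodivisor (R Quot Idl (set (take i xs))) (Idl (set (take i xs)) +> xs ! i)"
        if "i < length xs" for i
        using xs that unfolding regular_sequence_def by (simp add: Let_def)
      have reg1: "z = \<zero>" if "z \<in> carrier R" "x1 \<otimes> z = \<zero>" for z
      proof -
        have "nonzerodivisor (R Quot {\<zero>}) ({\<zero>} +> x1)" using nzd[of 0] by (simp add: eq genideal_empty)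
        then show ?thesis using nonzerodivisor_quot_iff[OF zeroideal c(1)] that by auto
      qed
      have J: "ideal (Idl {x1}) R" using c by (intro genideal_ideal) auto
      have reg2: "z \<in> Idl {x1}" if "z \<in> carrier R" "x2 \<otimes> z \<in> Idl {x1}" for z
      proof -
        have "nonzerodivisor (R Quot Idl {x1}) (Idl {x1} +> x2)" using nzd[of 1] by (simp add: eq)
        then show ?thesis using nonzerodivisor_quot_iff[OF J c(2)] that by auto
      qed
      obtain i k :: nat and z where z: "z \<in> carrier R" "y [^] k \<otimes> x1 [^] i = x1 [^] i \<otimes> (x1 \<otimes> z)"
        using power_relation[OF c(1)] by blast
      have eq0: "x1 [^] i \<otimes> (y [^] k \<ominus> x1 \<otimes> z) = \<zero>"
        using z c(1) parameter_closed by (intro mult_minus_eq_zero) auto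
      have cancel: "w = \<zero>" if "w \<in> carrier R" "x1 [^] n \<otimes> w = \<zero>" for n :: nat and w
        using that
      proof (induction n)
        case (Suc n)
        have "x1 \<otimes> (x1 [^] n \<otimes> w) = x1 [^] Suc n \<otimes> w"
          using c(1) Suc.prems(1) by (simp add: m_ac)
        then have "x1 \<otimes> (x1 [^] n \<otimes> w) = \<zero>" using Suc.prems(2) by (rule trans)
        then have "x1 [^] n \<otimes> w = \<zero>" using Suc.prems(1) c(1) by (blast intro: reg1 m_closed nat_pow_closed)
        then show ?case by (rule Suc.IH[OF Suc.prems(1)])
      qed auto
      have "y [^] k \<ominus> x1 \<otimes> z = \<zero>" by (rule cancel[OF _ eq0]) (use z c parameter_closed in simp)
      then have yk: "y [^] k = x1 \<otimes> z" using z c parameter_closed by auto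
      obtain j :: nat and w where w: "w \<in> carrier R" "x2 [^] j = y \<otimes> w"
        using power_in[OF c(3)] by blast
      have "x2 [^] (j * k) = (y \<otimes> w) [^] k" using w c by (simp flip: nat_pow_pow)
      also have "\<dots> = x1 \<otimes> (z \<otimes> w [^] k)"
        using w parameter_closed yk c z by (simp add: nat_pow_distrib m_assoc)
      finally have "x2 [^] (j * k) \<in> Idl {x1}"
        using w z c by (auto simp: genideal_singleton_iff)
      moreover have "\<one> \<in> Idl {x1}" if "x2 [^] n \<in> Idl {x1}" for n :: nat
        using that
      proof (induction n)
        case (Suc n)
        have "x2 [^] Suc n = x2 \<otimes> x2 [^] n" using c by (simp add: m_comm)
        then show ?case using reg2[of "x2 [^] n"] c Suc by (metis nat_pow_closed)
      qed auto
      ultimately have one: "\<one> \<in> Idl {x1}" by blast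
      have "Idl {x1} \<subseteq> Idl (set xs)"
        using xs by (intro subset_Idl_subset) (auto simp: regular_sequence_def eq)
      moreover have "ideal (Idl (set xs)) R"
        using xs by (intro genideal_ideal) (auto simp: regular_sequence_def)
      ultimately show False using one proper ideal.one_imp_carrier by blast
    qed
    then show "enat (length xs) \<le> 1" by (simp add: one_enat_def)
  qed
next
  have "Idl {y} \<subseteq> N" using yN by (intro genideal_minimal N.is_ideal) auto
  then have "Idl {y} \<noteq> carrier R" using N.I_notcarr N.a_subset by auto
  moreover have "nonzerodivisor (R Quot {\<zero>}) ({\<zero>} +> y)"
    using nonzerodivisor_quot_iff[OF zeroideal parameter_closed] regular by blast
  ultimately have "regular_sequence R [y]"
    using parameter_closed by (simp add: regular_sequence_def genideal_empty)
  then have "[y] \<in> {xs. regular_sequence R xs \<and> set xs \<subseteq> N}" using yN by simp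
  then have "enat (length [y]) \<le> depth R N"
    unfolding depth_def by (rule SUP_upper)
  then show "1 \<le> depth R N" by (simp add: one_enat_def)
qed

end
end

section \<open>Localization\<close>

locale mult_subset = cring R for R (structure) +
  fixes S
  assumes S_subset: "S \<subseteq> carrier R"
    and one_S: "\<one> \<in> S"
    and mult_S: "\<lbrakk>s \<in> S; t \<in> S\<rbrakk> \<Longrightarrow> s \<otimes> t \<in> S"
begin

abbreviation L where "L \<equiv> localization R S"
abbreviation frac (infix "\<oslash>" 72) where "frac \<equiv> ring_frac R S"

lemma S_closed [simp]: "s \<in> S \<Longrightarrow> s \<in> carrier R"
  using S_subset by auto

text \<open>Without cancellation in \<open>R\<close> the middle denominator \<open>t\<close> cannot
  be removed; it becomes part of the multiplier.\<close>

lemma frac_rel_trans: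
  assumes "a \<in> carrier R" "s \<in> S" "b \<in> carrier R" "t \<in> S" "c \<in> carrier R" "r \<in> S" "u \<in> S" "v \<in> S"
    and 1: "u \<otimes> (a \<otimes> t) = u \<otimes> (b \<otimes> s)" and 2: "v \<otimes> (b \<otimes> r) = v \<otimes> (c \<otimes> t)"
  shows "(u \<otimes> v \<otimes> t) \<otimes> (a \<otimes> r) = (u \<otimes> v \<otimes> t) \<otimes> (c \<otimes> s)"
proof -
  note [simp] = assms(1-8)
  have "(u \<otimes> v \<otimes> t) \<otimes> (a \<otimes> r) = (u \<otimes> (a \<otimes> t)) \<otimes> (v \<otimes> r)" by (simp add: m_ac)
  also have "\<dots> = (v \<otimes> (b \<otimes> r)) \<otimes> (u \<otimes> s)" unfolding 1 by (simp add: m_ac)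
  also have "\<dots> = (u \<otimes> v \<otimes> t) \<otimes> (c \<otimes> s)" unfolding 2 by (simp add: m_ac)
  finally show ?thesis .
qed

lemma equiv_frac_rel: "equiv (carrier R \<times> S) (frac_rel R S)"
proof (rule equivI)
  show "frac_rel R S \<subseteq> (carrier R \<times> S) \<times> carrier R \<times> S"
    by (auto simp: frac_rel_def)
  show "refl_on (carrier R \<times> S) (frac_rel R S)"
    using one_S by (auto simp: refl_on_def frac_rel_def)
  show "sym (frac_rel R S)"
    by (auto simp: sym_def frac_rel_def dest: sym)
  show "trans (frac_rel R S)"
  proof (rule transI)
    fix x y z assume "(x, y) \<in> frac_rel R S" "(y, z) \<in> frac_rel R S"
    then obtain a s b t c r u v where eq: "x = (a, s)" "y = (b, t)" "z = (c, r)"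
      and *: "a \<in> carrier R" "s \<in> S" "b \<in> carrier R" "t \<in> S" "c \<in> carrier R" "r \<in> S" "u \<in> S" "v \<in> S"
        "u \<otimes> (a \<otimes> t) = u \<otimes> (b \<otimes> s)" "v \<otimes> (b \<otimes> r) = v \<otimes> (c \<otimes> t)"
      by (auto simp: frac_rel_def)
    have "u \<otimes> v \<otimes> t \<in> S" using * mult_S by auto
    then show "(x, z) \<in> frac_rel R S"
      using frac_rel_trans[OF *] * by (auto simp: eq frac_rel_def)
  qed
qed

lemma frac_eq_iff:
  assumes "a \<in> carrier R" "s \<in> S" "b \<in> carrier R" "t \<in> S"
  shows "a \<oslash> s = b \<oslash> t \<longleftrightarrow> (\<exists>u\<in>S. u \<otimes> (a \<otimes> t) = u \<otimes> (b \<otimes> s))"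
  using assms eq_equiv_class_iff[OF equiv_frac_rel, of "(a, s)" "(b, t)"]
  by (auto simp: ring_frac_def frac_rel_def)

lemma frac_eqI:
  assumes "a \<in> carrier R" "s \<in> S" "b \<in> carrier R" "t \<in> S" "a \<otimes> t = b \<otimes> s"
  shows "a \<oslash> s = b \<oslash> t"
  using assms one_S by (subst frac_eq_iff) auto

lemma carrier_L: "carrier L = {a \<oslash> s |a s. a \<in> carrier R \<and> s \<in> S}"
  by (auto simp: localization_def quotient_def ring_frac_def)

lemma frac_closed [simp]: "a \<in> carrier R \<Longrightarrow> s \<in> S \<Longrightarrow> a \<oslash> s \<in> carrier L"
  by (auto simp: carrier_L)

text \<open>Sums and products in \<open>localization\<close> are unions over all representatives;
  this is the membership test used to evaluate them.\<close>

lemma in_frac_iff: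
  assumes "a \<in> carrier R" "s \<in> S"
  shows "(b, t) \<in> a \<oslash> s \<longleftrightarrow> b \<in> carrier R \<and> t \<in> S \<and> a \<oslash> s = b \<oslash> t"
proof -
  have "(b, t) \<in> a \<oslash> s \<longleftrightarrow> b \<in> carrier R \<and> t \<in> S \<and> (\<exists>u\<in>S. u \<otimes> (a \<otimes> t) = u \<otimes> (b \<otimes> s))"
    using assms by (simp add: ring_frac_def frac_rel_def)
  then show ?thesis using frac_eq_iff[OF assms, of b t] by blast
qed

lemma frac_mult_cong:
  assumes "a \<in> carrier R" "s \<in> S" "b \<in> carrier R" "t \<in> S" "a' \<in> carrier R" "s' \<in> S" "b' \<in> carrier R" "t' \<in> S"
    and "a \<oslash> s = a' \<oslash> s'" "b \<oslash> t = b' \<oslash> t'"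
  shows "(a \<otimes> b) \<oslash> (s \<otimes> t) = (a' \<otimes> b') \<oslash> (s' \<otimes> t')"
proof -
  note [simp] = assms(1-8)
  obtain u v where uv: "u \<in> S" "v \<in> S"
    and 1: "u \<otimes> (a \<otimes> s') = u \<otimes> (a' \<otimes> s)" and 2: "v \<otimes> (b \<otimes> t') = v \<otimes> (b' \<otimes> t)"
    using assms by (auto simp: frac_eq_iff)
  note [simp] = uv
  have "(u \<otimes> v) \<otimes> ((a \<otimes> b) \<otimes> (s' \<otimes> t')) = (u \<otimes> (a \<otimes> s')) \<otimes> (v \<otimes> (b \<otimes> t'))" by (simp add: m_ac)
  also have "\<dots> = (u \<otimes> v) \<otimes> ((a' \<otimes> b') \<otimes> (s \<otimes> t))" unfolding 1 2 by (simp add: m_ac)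
  finally show ?thesis
    using mult_S by (subst frac_eq_iff) (auto intro!: bexI[of _ "u \<otimes> v"])
qed

lemma frac_add_cong:
  assumes "a \<in> carrier R" "s \<in> S" "b \<in> carrier R" "t \<in> S" "a' \<in> carrier R" "s' \<in> S" "b' \<in> carrier R" "t' \<in> S"
    and "a \<oslash> s = a' \<oslash> s'" "b \<oslash> t = b' \<oslash> t'"
  shows "(a \<otimes> t \<oplus> b \<otimes> s) \<oslash> (s \<otimes> t) = (a' \<otimes> t' \<oplus> b' \<otimes> s') \<oslash> (s' \<otimes> t')"
proof -
  note [simp] = assms(1-8)
  obtain u v where uv: "u \<in> S" "v \<in> S"
    and 1: "u \<otimes> (a \<otimes> s') = u \<otimes> (a' \<otimes> s)" and 2: "v \<otimes> (b \<otimes> t') = v \<otimes> (b' \<otimes> t)"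
    using assms by (auto simp: frac_eq_iff)
  note [simp] = uv
  have "(u \<otimes> v) \<otimes> ((a \<otimes> t \<oplus> b \<otimes> s) \<otimes> (s' \<otimes> t')) =
      (u \<otimes> (a \<otimes> s')) \<otimes> (v \<otimes> (t \<otimes> t')) \<oplus> (v \<otimes> (b \<otimes> t')) \<otimes> (u \<otimes> (s \<otimes> s'))"
    by (simp add: m_ac l_distr r_distr)
  also have "\<dots> = (u \<otimes> v) \<otimes> ((a' \<otimes> t' \<oplus> b' \<otimes> s') \<otimes> (s \<otimes> t))"
    unfolding 1 2 by (simp add: m_ac l_distr r_distr)
  finally show ?thesis
    using mult_S by (subst frac_eq_iff) (auto intro!: bexI[of _ "u \<otimes> v"])
qed

lemma frac_self: "a \<in> carrier R \<Longrightarrow> s \<in> S \<Longrightarrow> (a, s) \<in> a \<oslash> s"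
  by (simp add: in_frac_iff)

text \<open>By \<open>frac_mult_cong\<close> all sets in the defining union are equal, and the union
  is over a nonempty family.\<close>

lemma mult_frac [simp]:
  assumes "a \<in> carrier R" "s \<in> S" "b \<in> carrier R" "t \<in> S"
  shows "(a \<oslash> s) \<otimes>\<^bsub>L\<^esub> (b \<oslash> t) = (a \<otimes> b) \<oslash> (s \<otimes> t)"
proof -
  let ?c = "(a \<otimes> b) \<oslash> (s \<otimes> t)"
  have eq: "(a' \<otimes> b') \<oslash> (s' \<otimes> t') = ?c"
    if "(a', s') \<in> a \<oslash> s" "(b', t') \<in> b \<oslash> t" for a' s' b' t'
    using that assms by (intro frac_mult_cong[symmetric]) (auto simp: in_frac_iff)
  have "(\<Union>(a', s')\<in>a \<oslash> s. \<Union>(b', t')\<in>b \<oslash> t. (a' \<otimes> b') \<oslash> (s' \<otimes> t')) = ?c"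
    using frac_self assms by (intro SUP_eq_const; clarify?) (auto intro!: SUP_eq_const eq)
  then show ?thesis by (simp add: localization_def)
qed

lemma add_frac [simp]:
  assumes "a \<in> carrier R" "s \<in> S" "b \<in> carrier R" "t \<in> S"
  shows "(a \<oslash> s) \<oplus>\<^bsub>L\<^esub> (b \<oslash> t) = (a \<otimes> t \<oplus> b \<otimes> s) \<oslash> (s \<otimes> t)"
proof -
  let ?c = "(a \<otimes> t \<oplus> b \<otimes> s) \<oslash> (s \<otimes> t)"
  have eq: "(a' \<otimes> t' \<oplus> b' \<otimes> s') \<oslash> (s' \<otimes> t') = ?c"
    if "(a', s') \<in> a \<oslash> s" "(b', t') \<in> b \<oslash> t" for a' s' b' t'
    using that assms by (intro frac_add_cong[symmetric]) (auto simp: in_frac_iff)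
  have "(\<Union>(a', s')\<in>a \<oslash> s. \<Union>(b', t')\<in>b \<oslash> t. (a' \<otimes> t' \<oplus> b' \<otimes> s') \<oslash> (s' \<otimes> t')) = ?c"
    using frac_self assms by (intro SUP_eq_const; clarify?) (auto intro!: SUP_eq_const eq)
  then show ?thesis by (simp add: localization_def)
qed

lemma one_L: "\<one>\<^bsub>L\<^esub> = \<one> \<oslash> \<one>"
  by (simp add: localization_def)

lemma zero_L: "\<zero>\<^bsub>L\<^esub> = \<zero> \<oslash> \<one>"
  by (simp add: localization_def)

lemma frac_zero [simp]: "s \<in> S \<Longrightarrow> \<zero> \<oslash> s = \<zero>\<^bsub>L\<^esub>"
  unfolding zero_L using one_S by (intro frac_eqI) auto

lemma carrier_L_cases:
  assumes "x \<in> carrier L"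
  obtains a s where "x = a \<oslash> s" "a \<in> carrier R" "s \<in> S"
  using assms by (auto simp: carrier_L)

lemma cring_L: "cring L"
proof (rule cringI)
  note [simp] = one_S mult_S
  show "abelian_group L"
  proof (rule abelian_groupI)
    fix x y z assume xyz: "x \<in> carrier L" "y \<in> carrier L" "z \<in> carrier L"
    show "x \<oplus>\<^bsub>L\<^esub> y \<in> carrier L" using xyz by (elim carrier_L_cases) simp
    from xyz show "(x \<oplus>\<^bsub>L\<^esub> y) \<oplus>\<^bsub>L\<^esub> z = x \<oplus>\<^bsub>L\<^esub> (y \<oplus>\<^bsub>L\<^esub> z)"
      by (elim carrier_L_cases, simp, intro frac_eqI) (simp_all add: m_ac l_distr r_distr a_ac)
    from xyz(1,2) show "x \<oplus>\<^bsub>L\<^esub> y = y \<oplus>\<^bsub>L\<^esub> x"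
      by (elim carrier_L_cases, simp, intro frac_eqI) (simp_all add: m_ac l_distr r_distr a_ac)
    from xyz(1) show "\<zero>\<^bsub>L\<^esub> \<oplus>\<^bsub>L\<^esub> x = x"
      by (elim carrier_L_cases, simp add: zero_L del: frac_zero)
    from xyz(1) obtain a s where "x = a \<oslash> s" "a \<in> carrier R" "s \<in> S" by (rule carrier_L_cases)
    then show "\<exists>y\<in>carrier L. y \<oplus>\<^bsub>L\<^esub> x = \<zero>\<^bsub>L\<^esub>"
      by (intro bexI[of _ "(\<ominus> a) \<oslash> s"]) (auto simp: l_minus l_neg)
  qed (simp add: zero_L del: frac_zero)
  show "comm_monoid L"
  proof (rule comm_monoidI)
    fix x y z assume xyz: "x \<in> carrier L" "y \<in> carrier L" "z \<in> carrier L"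
    show "x \<otimes>\<^bsub>L\<^esub> y \<in> carrier L" using xyz by (elim carrier_L_cases) simp
    from xyz show "(x \<otimes>\<^bsub>L\<^esub> y) \<otimes>\<^bsub>L\<^esub> z = x \<otimes>\<^bsub>L\<^esub> (y \<otimes>\<^bsub>L\<^esub> z)"
      by (elim carrier_L_cases) (simp add: m_ac)
    from xyz(1,2) show "x \<otimes>\<^bsub>L\<^esub> y = y \<otimes>\<^bsub>L\<^esub> x" by (elim carrier_L_cases) (simp add: m_ac)
    from xyz(1) show "\<one>\<^bsub>L\<^esub> \<otimes>\<^bsub>L\<^esub> x = x" by (elim carrier_L_cases) (simp add: one_L)
  qed (simp add: one_L)
  show "(x \<oplus>\<^bsub>L\<^esub> y) \<otimes>\<^bsub>L\<^esub> z = x \<otimes>\<^bsub>L\<^esub> z \<oplus>\<^bsub>L\<^esub> y \<otimes>\<^bsub>L\<^esub> z"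
    if "x \<in> carrier L" "y \<in> carrier L" "z \<in> carrier L" for x y z
    using that
    by (elim carrier_L_cases, simp, intro frac_eqI) (simp_all add: m_ac l_distr r_distr)
qed

lemma minus_frac:
  assumes "a \<in> carrier R" "s \<in> S"
  shows "\<ominus>\<^bsub>L\<^esub> (a \<oslash> s) = (\<ominus> a) \<oslash> s"
proof -
  interpret L: cring L by (rule cring_L)
  have "(\<ominus> a) \<oslash> s \<oplus>\<^bsub>L\<^esub> a \<oslash> s = \<zero>\<^bsub>L\<^esub>"
    using assms mult_S by (simp add: l_minus l_neg)
  then show ?thesis using assms by (intro L.minus_equality) auto
qed

lemma frac_hom: "ring_hom_ring R L (\<lambda>a. a \<oslash> \<one>)"
proof -
  interpret L: cring L by (rule cring_L)
  show ?thesis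
    by (intro ring_hom_ringI2 ring_hom_memI ring_axioms L.ring_axioms)
      (auto simp: one_S one_L)
qed

text \<open>Generators of the contraction \<open>J\<close> of \<open>I\<close> also generate
  \<open>I\<close>, because \<open>a \<oslash> s\<close> is \<open>a \<oslash> \<one>\<close> times
  \<open>\<one> \<oslash> s\<close>.\<close>

lemma noetherian_L:
  assumes "noetherian_ring R"
  shows "noetherian_ring L"
proof -
  interpret noetherian_ring R by fact
  interpret L: cring L by (rule cring_L)
  interpret h: ring_hom_ring R L "\<lambda>a. a \<oslash> \<one>" by (rule frac_hom)
  show ?thesis
  proof (rule L.noetherian_ringI)
    fix I assume I: "ideal I L"
    interpret I: ideal I L by (rule I)
    define J where "J = {a \<in> carrier R. a \<oslash> \<one> \<in> I}"
    have "ideal J R" unfolding J_def by (rule h.ideal_vimage[OF I])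
    then obtain F where F: "F \<subseteq> carrier R" "finite F" "J = Idl F" using finetely_gen by metis
    let ?F = "(\<lambda>a. a \<oslash> \<one>) ` F"
    have Fc: "?F \<subseteq> carrier L" using F one_S by auto
    note idl = L.genideal_ideal[OF Fc]
    interpret FI: ideal "Idl\<^bsub>L\<^esub> ?F" L by (rule idl)
    have "?F \<subseteq> I" using F genideal_self[OF F(1)] by (auto simp: J_def)
    then have 1: "Idl\<^bsub>L\<^esub> ?F \<subseteq> I" by (rule L.genideal_minimal[OF I])
    have 2: "J \<subseteq> {a \<in> carrier R. a \<oslash> \<one> \<in> Idl\<^bsub>L\<^esub> ?F}"
      unfolding F(3) using F L.genideal_self[OF Fc]
      by (intro genideal_minimal h.ideal_vimage[OF idl]) auto
    have "x \<in> Idl\<^bsub>L\<^esub> ?F" if x: "x \<in> I" for x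
    proof -
      obtain a s where as: "x = a \<oslash> s" "a \<in> carrier R" "s \<in> S"
        using I.Icarr[OF x] by (auto simp: carrier_L)
      have "a \<oslash> \<one> = x \<otimes>\<^bsub>L\<^esub> (s \<oslash> \<one>)" using as one_S by (simp, intro frac_eqI) (auto simp: m_ac)
      also have "\<dots> \<in> I" using x as one_S by (intro I.I_r_closed) auto
      finally have "a \<oslash> \<one> \<in> Idl\<^bsub>L\<^esub> ?F" using 2 as by (auto simp: J_def)
      then have "a \<oslash> \<one> \<otimes>\<^bsub>L\<^esub> (\<one> \<oslash> s) \<in> Idl\<^bsub>L\<^esub> ?F" using as by (intro FI.I_r_closed) auto
      then show ?thesis using as one_S by simp
    qed
    with 1 have "I = Idl\<^bsub>L\<^esub> ?F" by auto
    then show "\<exists>A\<subseteq>carrier L. finite A \<and> I = Idl\<^bsub>L\<^esub> A" using Fc F by blast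
  qed
qed

end

section \<open>The localization at a prime ideal is local\<close>

locale localization_at_prime = primeideal M R + mult_subset R S for M and R (structure) and S +
  assumes S_iff: "s \<in> S \<longleftrightarrow> s \<in> carrier R \<and> s \<notin> M"
begin

definition N where "N = {a \<oslash> s |a s. a \<in> M \<and> s \<in> S}"

lemma frac_in_N_iff:
  assumes "a \<in> carrier R" "s \<in> S"
  shows "a \<oslash> s \<in> N \<longleftrightarrow> a \<in> M"
proof
  assume "a \<oslash> s \<in> N"
  then obtain b t where bt: "b \<in> M" "t \<in> S" "a \<oslash> s = b \<oslash> t" by (auto simp: N_def)
  then obtain u where u: "u \<in> S" "u \<otimes> (a \<otimes> t) = u \<otimes> (b \<otimes> s)"
    using assms frac_eq_iff[of a s b t] Icarr by auto
  have "u \<otimes> (b \<otimes> s) \<in> M" using bt u assms by (intro I_l_closed I_r_closed) auto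
  then show "a \<in> M" using u bt assms I_prime by (metis S_iff m_closed)
qed (use assms in \<open>auto simp: N_def\<close>)

lemma ideal_N: "ideal N L"
proof -
  interpret L: cring L by (rule cring_L)
  have N: "x \<in> N \<longleftrightarrow> (\<exists>a s. x = a \<oslash> s \<and> a \<in> M \<and> s \<in> S)" for x by (auto simp: N_def)
  show ?thesis
  proof (rule idealI[OF L.ring_axioms])
    show "subgroup N (add_monoid L)"
    proof (rule subgroup.intro)
      show "N \<subseteq> carrier (add_monoid L)" using Icarr by (auto simp: N_def)
      show "\<one>\<^bsub>add_monoid L\<^esub> \<in> N" using one_S zero_closed frac_in_N_iff[of \<zero> \<one>] by simp
      show "x \<otimes>\<^bsub>add_monoid L\<^esub> y \<in> N" if xy: "x \<in> N" "y \<in> N" for x y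
      proof -
        obtain a s b t where *: "x = a \<oslash> s" "y = b \<oslash> t" "a \<in> M" "b \<in> M" "s \<in> S" "t \<in> S"
          using xy unfolding N by blast
        have "a \<otimes> t \<oplus> b \<otimes> s \<in> M" using * by (blast intro: additive_subgroup.a_closed[OF ideal.axioms(1)[OF is_ideal]] I_r_closed S_closed)
        then show ?thesis using * mult_S Icarr by (auto simp: frac_in_N_iff)
      qed
      show "inv\<^bsub>add_monoid L\<^esub> x \<in> N" if x: "x \<in> N" for x
      proof -
        obtain a s where *: "x = a \<oslash> s" "a \<in> M" "s \<in> S" using x unfolding N by blast
        have "\<ominus>\<^bsub>L\<^esub> x \<in> N" using * minus_frac[of a s] Icarr by (auto simp: frac_in_N_iff)
        then show ?thesis by (simp add: a_inv_def)
      qed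
    qed
    show left: "y \<otimes>\<^bsub>L\<^esub> x \<in> N" if xy: "x \<in> N" "y \<in> carrier L" for x y
    proof -
      obtain a s b t where *: "x = a \<oslash> s" "y = b \<oslash> t" "a \<in> M" "b \<in> carrier R" "s \<in> S" "t \<in> S"
        using xy unfolding N carrier_L by blast
      then show ?thesis using mult_S Icarr I_l_closed by (auto simp: frac_in_N_iff)
    qed
    show "x \<otimes>\<^bsub>L\<^esub> y \<in> N" if "x \<in> N" "y \<in> carrier L" for x y
    proof -
      have "x \<in> carrier L" using that Icarr by (auto simp: N_def)
      then show ?thesis using left[OF that] that L.m_comm by simp
    qed
  qed
qed

text \<open>A fraction whose numerator lies outside \<open>M\<close> is a unit, with inverse
  \<open>s \<oslash> a\<close>.\<close>

lemma proper_ideal_subset_N: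
  assumes J: "ideal J L" and proper: "J \<noteq> carrier L"
  shows "J \<subseteq> N"
proof
  interpret J: ideal J L by (rule J)
  fix x assume x: "x \<in> J"
  obtain a s where as: "x = a \<oslash> s" "a \<in> carrier R" "s \<in> S"
    using J.Icarr[OF x] unfolding carrier_L by blast
  have "a \<in> M"
  proof (rule ccontr)
    assume "a \<notin> M"
    then have "\<one>\<^bsub>L\<^esub> = x \<otimes>\<^bsub>L\<^esub> (s \<oslash> a)"
      using as S_iff one_S mult_S by (simp add: one_L, intro frac_eqI) (auto simp: m_comm)
    also have "\<dots> \<in> J" using x as \<open>a \<notin> M\<close> S_iff by (intro J.I_r_closed) auto
    finally show False using J.one_imp_carrier proper by simp
  qed
  then show "x \<in> N" using as frac_in_N_iff by simp
qed

lemma one_notin_N: "\<one>\<^bsub>L\<^esub> \<notin> N"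
  using one_S S_iff by (simp add: one_L frac_in_N_iff)

lemma maximalideal_N: "maximalideal N L"
proof (rule maximalidealI[OF ideal_N])
  show "carrier L \<noteq> N" using one_notin_N cring.cring_simprules(6)[OF cring_L] by blast
  show "J = N \<or> J = carrier L" if "ideal J L" "N \<subseteq> J" for J
    using proper_ideal_subset_N[OF that(1)] that(2) by blast
qed

lemma maximalideal_L_unique:
  assumes "maximalideal N' L"
  shows "N' = N"
proof -
  interpret N': maximalideal N' L by fact
  have "N' \<subseteq> N" using proper_ideal_subset_N[OF N'.is_ideal] N'.I_notcarr by auto
  moreover have "N \<subseteq> carrier L" using Icarr by (auto simp: N_def)
  moreover have "N \<noteq> carrier L" using one_notin_N cring.cring_simprules(6)[OF cring_L] by blast
  ultimately show ?thesis using N'.I_maximal[OF ideal_N] by blast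
qed

end

text \<open>The factors from \<open>S\<close> allowed in the hypotheses become units in
  \<open>L\<close>, so \<open>y \<oslash> \<one>\<close> satisfies everything that
  \<open>depth_eq_1\<close> and \<open>krull_dim_eq_1\<close> require.\<close>

lemma (in localization_at_prime) cohen_macaulay_localI:
  assumes "noetherian_ring R"
    and y: "y \<in> M" "\<And>z. z \<in> carrier R \<Longrightarrow> y \<otimes> z = \<zero> \<Longrightarrow> z = \<zero>"
    and power_in_parameter: "\<And>g. g \<in> M \<Longrightarrow> \<exists>(i::nat). \<exists>s\<in>S. \<exists>z\<in>carrier R. s \<otimes> g [^] i = y \<otimes> z"
    and relation: "\<And>g. g \<in> carrier R \<Longrightarrow> \<exists>(i::nat) (k::nat). \<exists>s\<in>S. \<exists>z\<in>carrier R.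
      s \<otimes> (y [^] k \<otimes> g [^] i) = g [^] i \<otimes> (g \<otimes> z)"
  shows "cohen_macaulay_local L"
proof -
  interpret L: cring L by (rule cring_L)
  have frac_pow: "(a \<oslash> s) [^]\<^bsub>L\<^esub> n = (a [^] n) \<oslash> (s [^] n) \<and> s [^] n \<in> S"
    if "a \<in> carrier R" "s \<in> S" for a s and n :: nat
  proof (induction n)
    case 0
    then show ?case using one_S by (simp add: one_L)
  next
    case (Suc n)
    moreover have "s [^] n \<otimes> s \<in> S" using Suc that mult_S by blast
    ultimately show ?case using that by simp
  qed
  have yc: "y \<in> carrier R" using y(1) Icarr by simp
  have yL: "y \<oslash> \<one> \<in> N" using y(1) yc one_S frac_in_N_iff by blast
  have regular: "z = \<zero>\<^bsub>L\<^esub>" if z: "z \<in> carrier L" "(y \<oslash> \<one>) \<otimes>\<^bsub>L\<^esub> z = \<zero>\<^bsub>L\<^esub>" for z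
  proof -
    obtain a s where as: "z = a \<oslash> s" "a \<in> carrier R" "s \<in> S"
      using z(1) by (rule carrier_L_cases)
    then have "(y \<otimes> a) \<oslash> s = \<zero> \<oslash> \<one>" using z(2) yc one_S by (simp add: zero_L del: frac_zero)
    then obtain u where u: "u \<in> S" "u \<otimes> (y \<otimes> a \<otimes> \<one>) = u \<otimes> (\<zero> \<otimes> s)"
      using as yc one_S frac_eq_iff[of "y \<otimes> a" s \<zero> \<one>] by auto
    then have "y \<otimes> (u \<otimes> a) = \<zero>" using as yc by (simp add: m_lcomm)
    then have "u \<otimes> a = \<zero>" using y(2)[of "u \<otimes> a"] u(1) as by simp
    then have "u \<otimes> (a \<otimes> \<one>) = u \<otimes> (\<zero> \<otimes> s)" using u as by simp
    then have "a \<oslash> s = \<zero> \<oslash> \<one>" using as u one_S frac_eq_iff[of a s \<zero> \<one>] by blast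
    then show ?thesis using as by (simp add: zero_L del: frac_zero)
  qed
  have power_in: "\<exists>i::nat. \<exists>z\<in>carrier L. g [^]\<^bsub>L\<^esub> i = (y \<oslash> \<one>) \<otimes>\<^bsub>L\<^esub> z" if g: "g \<in> N" for g
  proof -
    obtain a s where as: "g = a \<oslash> s" "a \<in> M" "s \<in> S" using g unfolding N_def by blast
    have ac: "a \<in> carrier R" using as Icarr by simp
    obtain i :: nat and t z where t: "t \<in> S" "z \<in> carrier R" "t \<otimes> a [^] i = y \<otimes> z"
      using power_in_parameter[OF as(2)] by blast
    note fp = frac_pow[OF ac as(3), of i]
    have st: "t \<otimes> s [^] i \<in> S" using fp t mult_S by blast
    have "(a [^] i) \<oslash> (s [^] i) = (y \<otimes> z) \<oslash> (t \<otimes> s [^] i)"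
      using fp st t ac yc by (intro frac_eqI) (auto simp flip: t(3) simp: m_ac)
    also have "\<dots> = (y \<oslash> \<one>) \<otimes>\<^bsub>L\<^esub> (z \<oslash> (t \<otimes> s [^] i))" using st t yc one_S by simp
    finally show ?thesis using fp as(1) st t by (metis frac_closed)
  qed
  have power_relation: "\<exists>(i::nat) (k::nat). \<exists>z\<in>carrier L.
      (y \<oslash> \<one>) [^]\<^bsub>L\<^esub> k \<otimes>\<^bsub>L\<^esub> g [^]\<^bsub>L\<^esub> i = g [^]\<^bsub>L\<^esub> i \<otimes>\<^bsub>L\<^esub> (g \<otimes>\<^bsub>L\<^esub> z)"
    if g: "g \<in> carrier L" for g
  proof -
    obtain a s where as: "g = a \<oslash> s" "a \<in> carrier R" "s \<in> S"
      using g by (rule carrier_L_cases)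
    obtain i k :: nat and t z where t: "t \<in> S" "z \<in> carrier R"
      "t \<otimes> (y [^] k \<otimes> a [^] i) = a [^] i \<otimes> (a \<otimes> z)"
      using relation[OF as(2)] by blast
    note fp = frac_pow[OF as(2,3), of i]
    have st: "s [^] i \<otimes> (s \<otimes> t) \<in> S" "s \<otimes> t \<in> S"
      using fp t as mult_S by blast+
    have sc: "s \<in> carrier R" "t \<in> carrier R" using as t by auto
    have "(y \<oslash> \<one>) [^]\<^bsub>L\<^esub> k \<otimes>\<^bsub>L\<^esub> g [^]\<^bsub>L\<^esub> i = (y [^] k \<otimes> a [^] i) \<oslash> (s [^] i)"
      using fp frac_pow[OF yc one_S, of k] as yc one_S by simp
    \<comment> \<open>The right-hand side has one factor \<open>g\<close> more than the left and so
      one more \<open>s\<close> in the denominator; replacing \<open>z\<close> by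
      \<open>z \<otimes> s\<close> makes up for it.\<close>
    also have "\<dots> = (a [^] i \<otimes> (a \<otimes> (z \<otimes> s))) \<oslash> (s [^] i \<otimes> (s \<otimes> t))"
    proof (rule frac_eqI)
      have "(y [^] k \<otimes> a [^] i) \<otimes> (s [^] i \<otimes> (s \<otimes> t)) = (t \<otimes> (y [^] k \<otimes> a [^] i)) \<otimes> (s [^] i \<otimes> s)"
        using sc as yc by (simp add: m_ac)
      also have "\<dots> = a [^] i \<otimes> (a \<otimes> (z \<otimes> s)) \<otimes> s [^] i"
        unfolding t(3) using sc as t(2) by (simp add: m_ac)
      finally show "(y [^] k \<otimes> a [^] i) \<otimes> (s [^] i \<otimes> (s \<otimes> t)) = a [^] i \<otimes> (a \<otimes> (z \<otimes> s)) \<otimes> s [^] i" .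
    qed (use fp st sc as t yc in auto)
    also have "\<dots> = g [^]\<^bsub>L\<^esub> i \<otimes>\<^bsub>L\<^esub> (g \<otimes>\<^bsub>L\<^esub> ((z \<otimes> s) \<oslash> t))"
      using fp as t st sc by simp
    finally show ?thesis using t sc frac_closed[of "z \<otimes> s" t] by blast
  qed
  have local: "P \<subseteq> N" if "primeideal P L" for P
    using proper_ideal_subset_N that by (metis primeideal.I_notcarr primeideal.axioms(1))
  have "depth L N = 1" "krull_dim L = 1"
    using L.depth_eq_1[OF maximalideal_N yL regular local power_in power_relation]
      L.krull_dim_eq_1[OF maximalideal_N yL regular local power_in power_relation] by auto
  then show ?thesis
    using cring_L noetherian_L[OF assms(1)] maximalideal_N maximalideal_L_unique
    unfolding cohen_macaulay_local_def by metis
qed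

section \<open>Finite torsion-free algebras over a Euclidean ring\<close>

text \<open>As \<open>f\<close> is no unit, splitting off a factor \<open>f\<close> strictly
  decreases the Euclidean size, so this can be done only finitely often.\<close>

lemma exists_power_cofactor:
  fixes f c :: "'p::euclidean_semiring"
  assumes "\<not> f dvd 1" "c \<noteq> 0"
  shows "\<exists>k d. c = f ^ k * d \<and> \<not> f dvd d"
  using assms(2)
proof (induction "euclidean_size c" arbitrary: c rule: less_induct)
  case less
  show ?case
  proof (cases "f dvd c")
    case True
    then obtain d where d: "c = f * d" by auto
    then have "d \<noteq> 0" and "d dvd c" using less by auto
    moreover have "\<not> c dvd d"
    proof
      assume "c dvd d"
      then obtain e where "d = c * e" by auto
      then have "d * 1 = d * (f * e)" using d by (simp add: ac_simps)
      then have "1 = f * e" using \<open>d \<noteq> 0\<close> mult_left_cancel by blast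
      then show False using assms(1) by (metis dvd_triv_left)
    qed
    ultimately have "euclidean_size d < euclidean_size c"
      using less by (intro dvd_proper_imp_size_less) auto
    then obtain k e where "d = f ^ k * e" "\<not> f dvd e" using less(1)[of d] \<open>d \<noteq> 0\<close> by blast
    then have "c = f ^ Suc k * e" using d by (simp add: ac_simps)
    then show ?thesis using \<open>\<not> f dvd e\<close> by blast
  next
    case False
    then have "c = f ^ 0 * c \<and> \<not> f dvd c" by simp
    then show ?thesis by blast
  qed
qed

text \<open>\<open>B_generates\<close> says that \<open>B\<close> generates \<open>R\<close> as a
  module over \<open>'p\<close>, in the form of an induction principle that needs no linear
  combinations. \<open>nonunit_exists\<close> says that \<open>'p\<close> is not a field.\<close>

locale finite_torsion_free_algebra = cring R for R (structure) +
  fixes \<phi> :: "'p::euclidean_ring \<Rightarrow> 'a" and B :: "'a set"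
  assumes \<phi>_closed [simp]: "\<phi> p \<in> carrier R"
    and \<phi>_add: "\<phi> (p + q) = \<phi> p \<oplus> \<phi> q"
    and \<phi>_mult: "\<phi> (p * q) = \<phi> p \<otimes> \<phi> q"
    and \<phi>_one: "\<phi> 1 = \<one>"
    and torsion_free: "\<lbrakk>g \<in> carrier R; \<phi> p \<otimes> g = \<zero>; p \<noteq> 0\<rbrakk> \<Longrightarrow> g = \<zero>"
    and finite_B: "finite B"
    and B_closed: "B \<subseteq> carrier R"
    and B_generates: "\<And>S g. \<lbrakk>B \<subseteq> S; \<zero> \<in> S; \<And>a b. a \<in> S \<Longrightarrow> b \<in> S \<Longrightarrow> a \<oplus> b \<in> S;
      \<And>p a. a \<in> S \<Longrightarrow> \<phi> p \<otimes> a \<in> S; g \<in> carrier R\<rbrakk> \<Longrightarrow> g \<in> S"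
    and nonunit_exists: "\<exists>x::'p. x \<noteq> 0 \<and> \<not> x dvd 1"
begin

lemma \<phi>_zero: "\<phi> 0 = \<zero>"
  using \<phi>_add[of 0 0] by (metis \<phi>_closed add.l_cancel_one' add.right_neutral)

lemma \<phi>_power: "\<phi> (p ^ n) = \<phi> p [^] n"
  by (induction n) (auto simp: \<phi>_one \<phi>_mult m_comm)

lemma \<phi>_minus_cancel [simp]:
  assumes "z \<in> carrier R"
  shows "\<phi> p \<otimes> z \<oplus> \<phi> (- p) \<otimes> z = \<zero>"
  using assms by (simp add: \<phi>_zero flip: l_distr \<phi>_add)

section \<open>Submodules are finitely generated\<close>

definition submod where
  "submod S \<longleftrightarrow> S \<subseteq> carrier R \<and> \<zero> \<in> S \<and> (\<forall>a\<in>S. \<forall>b\<in>S. a \<oplus> b \<in> S) \<and> (\<forall>p. \<forall>a\<in>S. \<phi> p \<otimes> a \<in> S)"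

lemma submodD:
  assumes "submod S"
  shows "S \<subseteq> carrier R" "a \<in> S \<Longrightarrow> a \<in> carrier R" "\<zero> \<in> S"
    "a \<in> S \<Longrightarrow> b \<in> S \<Longrightarrow> a \<oplus> b \<in> S" "a \<in> S \<Longrightarrow> \<phi> p \<otimes> a \<in> S"
  using assms by (auto simp: submod_def)

text \<open>Recursion over a list of generators allows one generator to be split off at a
  time.\<close>

primrec span where
  "span [] = {\<zero>}"
| "span (h # hs) = {\<phi> p \<otimes> h \<oplus> v |p v. v \<in> span hs}"

lemma submod_span: "set hs \<subseteq> carrier R \<Longrightarrow> submod (span hs)"
proof (induction hs)
  case Nil
  then show ?case by (auto simp: submod_def)
next
  case (Cons h hs)
  then have S: "submod (span hs)" and h: "h \<in> carrier R" by auto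
  note [simp] = submodD(2)[OF S]
  show ?case
    unfolding submod_def
  proof (intro conjI ballI allI)
    show "span (h # hs) \<subseteq> carrier R" using h by auto
    have "\<zero> = \<phi> 0 \<otimes> h \<oplus> \<zero>" using h by (simp add: \<phi>_zero)
    then show "\<zero> \<in> span (h # hs)" using submodD(3)[OF S] by auto
  next
    fix a b assume "a \<in> span (h # hs)" "b \<in> span (h # hs)"
    then obtain p q v w where *: "a = \<phi> p \<otimes> h \<oplus> v" "b = \<phi> q \<otimes> h \<oplus> w" "v \<in> span hs" "w \<in> span hs"
      by auto
    have "a \<oplus> b = \<phi> (p + q) \<otimes> h \<oplus> (v \<oplus> w)" using * h by (simp add: \<phi>_add l_distr a_ac)
    then show "a \<oplus> b \<in> span (h # hs)" using * submodD(4)[OF S] by auto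
  next
    fix a q assume "a \<in> span (h # hs)"
    then obtain p v where *: "a = \<phi> p \<otimes> h \<oplus> v" "v \<in> span hs" by auto
    have "\<phi> q \<otimes> a = \<phi> (q * p) \<otimes> h \<oplus> \<phi> q \<otimes> v" using * h by (simp add: \<phi>_mult r_distr m_assoc)
    then show "\<phi> q \<otimes> a \<in> span (h # hs)" using * submodD(5)[OF S] by auto
  qed
qed

lemma span_subset: "submod S \<Longrightarrow> set hs \<subseteq> S \<Longrightarrow> span hs \<subseteq> S"
  by (induction hs) (auto simp: submodD)

lemma submod_finitely_generated:
  assumes "set hs \<subseteq> carrier R" "submod S" "S \<subseteq> span hs"
  shows "\<exists>ks. set ks \<subseteq> S \<and> S \<subseteq> span ks"
  using assms
proof (induction hs arbitrary: S)
  case Nil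
  then show ?case by (intro exI[of _ "[]"]) auto
next
  case (Cons h hs)
  have h: "h \<in> carrier R" and hs: "submod (span hs)" using Cons.prems submod_span by auto
  note [simp] = submodD(2)[OF hs] submodD(2)[OF Cons.prems(2)]
  define I where "I = {p. \<exists>v\<in>span hs. \<phi> p \<otimes> h \<oplus> v \<in> S}"
  show ?case
  proof (cases "I \<subseteq> {0}")
    case True
    have "S \<subseteq> span hs"
    proof
      fix s assume s: "s \<in> S"
      then obtain p v where pv: "s = \<phi> p \<otimes> h \<oplus> v" "v \<in> span hs" using Cons.prems(3) by auto
      then have "p \<in> I" using s by (auto simp: I_def)
      then show "s \<in> span hs" using True pv h by (auto simp: \<phi>_zero)
    qed
    then show ?thesis using Cons by auto
  next
    case False
    obtain d where d: "d \<in> I" "d \<noteq> 0" and min: "\<And>p. p \<in> I \<Longrightarrow> p \<noteq> 0 \<Longrightarrow> euclidean_size d \<le> euclidean_size p"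
    proof -
      obtain e where "e \<in> I \<and> e \<noteq> 0" using False by auto
      from ex_has_least_nat[of "\<lambda>p. p \<in> I \<and> p \<noteq> 0", OF this, of euclidean_size]
      show ?thesis using that by blast
    qed
    obtain v where v: "v \<in> span hs" "\<phi> d \<otimes> h \<oplus> v \<in> S" using d by (auto simp: I_def)
    define z where "z = \<phi> d \<otimes> h \<oplus> v"
    have z: "z \<in> S" "z \<in> carrier R" using v h by (auto simp: z_def)
    have "submod (S \<inter> span hs)" using Cons.prems(2) hs by (auto simp: submod_def)
    then obtain ks where ks: "set ks \<subseteq> S \<inter> span hs" "S \<inter> span hs \<subseteq> span ks"
      using Cons.IH[of "S \<inter> span hs"] Cons.prems(1) by auto
    have "s \<in> span (z # ks)" if s: "s \<in> S" for s
    proof -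
      obtain p w where pw: "s = \<phi> p \<otimes> h \<oplus> w" "w \<in> span hs" using s Cons.prems(3) by auto
      \<comment> \<open>Subtracting \<open>q\<close> times \<open>z\<close> leaves the remainder
        \<open>p mod d\<close> as coefficient of \<open>h\<close>, and minimality of
        \<open>d\<close> makes it zero.\<close>
      define q where "q = p div d"
      define t where "t = s \<oplus> \<phi> (- q) \<otimes> z"
      have t: "t \<in> S" using s z Cons.prems(2) by (auto simp: t_def submodD)
      have w': "w \<oplus> \<phi> (- q) \<otimes> v \<in> span hs" using pw v hs by (auto simp: submodD)
      have "p mod d = p + (- q) * d" by (simp add: q_def minus_div_mult_eq_mod)
      then have mod: "\<phi> (p mod d) = \<phi> p \<oplus> \<phi> (- q) \<otimes> \<phi> d" by (simp only: \<phi>_add \<phi>_mult)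
      then have t_eq: "t = \<phi> (p mod d) \<otimes> h \<oplus> (w \<oplus> \<phi> (- q) \<otimes> v)"
        unfolding t_def z_def pw using h pw v
        by (simp add: mod l_distr r_distr m_assoc a_ac)
      then have "p mod d \<in> I" using t w' by (auto simp: I_def)
      then have "p mod d = 0" using min[of "p mod d"] mod_size_less[OF d(2), of p] by fastforce
      then have "t \<in> span hs" using t_eq w' h by (auto simp: \<phi>_zero)
      then have "t \<in> span ks" using t ks by auto
      moreover have "s = \<phi> q \<otimes> z \<oplus> t"
      proof -
        have "\<phi> q \<otimes> z \<oplus> t = (\<phi> q \<otimes> z \<oplus> \<phi> (- q) \<otimes> z) \<oplus> s"
          unfolding t_def using s z by (simp add: a_ac del: \<phi>_minus_cancel)
        then show ?thesis using s z by simp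
      qed
      ultimately show ?thesis by auto
    qed
    then show ?thesis using ks z by (intro exI[of _ "z # ks"]) auto
  qed
qed

lemma set_subset_span: "set hs \<subseteq> carrier R \<Longrightarrow> set hs \<subseteq> span hs"
proof (induction hs)
  case (Cons h hs)
  have S: "submod (span hs)" using Cons.prems submod_span by auto
  have "h = \<phi> 1 \<otimes> h \<oplus> \<zero>" using Cons.prems by (simp add: \<phi>_one)
  then have "h \<in> span (h # hs)" using submodD(3)[OF S] unfolding span.simps by blast
  moreover have "v \<in> span (h # hs)" if "v \<in> span hs" for v
  proof -
    have "v = \<phi> 0 \<otimes> h \<oplus> v" using that Cons.prems submodD(2)[OF S] by (simp add: \<phi>_zero)
    then show ?thesis using that unfolding span.simps by blast
  qed
  ultimately show ?case using Cons by auto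
qed auto

lemma submod_fg:
  assumes "submod S"
  shows "\<exists>ks. set ks \<subseteq> S \<and> S \<subseteq> span ks"
proof -
  obtain bs where bs: "set bs = B" using finite_list[OF finite_B] by blast
  then have c: "set bs \<subseteq> carrier R" using B_closed by simp
  have "g \<in> span bs" if "g \<in> carrier R" for g
    by (rule B_generates) (use submodD[OF submod_span[OF c]] set_subset_span[OF c] bs that in auto)
  then have "S \<subseteq> span bs" using submodD(1)[OF assms] by blast
  then show ?thesis by (rule submod_finitely_generated[OF c assms])
qed

lemma submod_ideal: "ideal I R \<Longrightarrow> submod I"
  unfolding submod_def
  by (meson additive_subgroup.a_closed additive_subgroup.a_subset additive_subgroup.zero_closed
      ideal.I_l_closed ideal.axioms(1) \<phi>_closed)

text \<open>Ideals are submodules, and generators as a submodule generate all the more as an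
  ideal.\<close>

lemma noetherian: "noetherian_ring R"
proof (rule noetherian_ringI)
  fix I assume I: "ideal I R"
  obtain ks where ks: "set ks \<subseteq> I" "I \<subseteq> span ks"
    using submod_fg[OF submod_ideal[OF I]] by auto
  have c: "set ks \<subseteq> carrier R" using ks submodD(1)[OF submod_ideal[OF I]] by auto
  have "span ks \<subseteq> Idl (set ks)"
    using genideal_self[OF c] by (intro span_subset submod_ideal genideal_ideal c)
  moreover have "Idl (set ks) \<subseteq> I" by (rule genideal_minimal[OF I ks(1)])
  ultimately show "\<exists>A\<subseteq>carrier R. finite A \<and> I = Idl A" using ks c by blast
qed

section \<open>Integrality over the Euclidean ring\<close>

primrec horner where
  "horner g [] = \<zero>"
| "horner g (a # as) = \<phi> a \<oplus> g \<otimes> horner g as"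

lemma horner_closed [simp]: "g \<in> carrier R \<Longrightarrow> horner g as \<in> carrier R"
  by (induction as) auto

lemma horner_append:
  "g \<in> carrier R \<Longrightarrow> horner g (as @ bs) = horner g as \<oplus> g [^] length as \<otimes> horner g bs"
proof (induction as)
  case (Cons a as)
  have "g [^] length (a # as) = g \<otimes> g [^] length as" using Cons.prems by (simp add: m_comm)
  then show ?case using Cons by (simp add: r_distr m_assoc a_assoc)
qed auto

lemma horner_scale: "g \<in> carrier R \<Longrightarrow> horner g (map ((*) p) as) = \<phi> p \<otimes> horner g as"
  by (induction as) (auto simp: \<phi>_mult r_distr m_lcomm)

lemma horner_add:
  "g \<in> carrier R \<Longrightarrow> length as = length bs \<Longrightarrow>
    horner g (map2 (+) as bs) = horner g as \<oplus> horner g bs"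
proof (induction as bs rule: list_induct2')
  case (4 a as b bs)
  then show ?case by (simp add: \<phi>_add r_distr a_ac)
qed auto

lemma horner_zeros: "g \<in> carrier R \<Longrightarrow> horner g (replicate n 0) = \<zero>"
  by (induction n) (auto simp: \<phi>_zero)

text \<open>The values at \<open>g\<close> of polynomials with \<open>n\<close> coefficients form a
  submodule \<open>U n\<close>, increasing with \<open>n\<close>. The union is finitely generated,
  so it equals some \<open>U n\<close>; then \<open>g [^] n\<close> is a combination of lower powers
  of \<open>g\<close>.\<close>

lemma integral_over:
  assumes g: "g \<in> carrier R"
  shows "\<exists>as. horner g (as @ [1]) = \<zero>"
proof -
  define U where "U n = {horner g as |as. length as = n}" for n
  have sub: "submod (U n)" for n
    unfolding submod_def
  proof (intro conjI ballI allI)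
    have "\<zero> = horner g (replicate n 0)" "length (replicate n (0::'p)) = n" using horner_zeros[OF g] by auto
    then show "\<zero> \<in> U n" unfolding U_def by blast
    fix a b assume "a \<in> U n" "b \<in> U n"
    then obtain as bs where "a = horner g as" "b = horner g bs" "length as = n" "length bs = n"
      by (auto simp: U_def)
    then have "a \<oplus> b = horner g (map2 (+) as bs)" "length (map2 (+) as bs) = n"
      using horner_add[OF g] by auto
    then show "a \<oplus> b \<in> U n" unfolding U_def by blast
  next
    fix p a assume "a \<in> U n"
    then obtain as where "a = horner g as" "length as = n" by (auto simp: U_def)
    then have "\<phi> p \<otimes> a = horner g (map ((*) p) as)" "length (map ((*) p) as) = n"
      using horner_scale[OF g] by auto
    then show "\<phi> p \<otimes> a \<in> U n" unfolding U_def by blast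
  qed (use g in \<open>auto simp: U_def\<close>)
  have mono: "U m \<subseteq> U n" if "m \<le> n" for m n
  proof
    fix a assume "a \<in> U m"
    then obtain as where "a = horner g as" "length as = m" by (auto simp: U_def)
    then have "a = horner g (as @ replicate (n - m) 0)" "length (as @ replicate (n - m) 0) = n"
      using that g horner_zeros[OF g] by (auto simp: horner_append)
    then show "a \<in> U n" unfolding U_def by blast
  qed
  have "submod (\<Union>n. U n)"
    unfolding submod_def
  proof (intro conjI ballI allI)
    fix a b assume "a \<in> (\<Union>n. U n)" "b \<in> (\<Union>n. U n)"
    then obtain m n where "a \<in> U m" "b \<in> U n" by auto
    then have "a \<in> U (max m n)" "b \<in> U (max m n)" using mono[of m "max m n"] mono[of n "max m n"] by auto
    then show "a \<oplus> b \<in> (\<Union>n. U n)" using submodD(4)[OF sub] by blast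
  next
    show "(\<Union>n. U n) \<subseteq> carrier R" using submodD(1)[OF sub] by blast
    show "\<zero> \<in> (\<Union>n. U n)" using submodD(3)[OF sub] by blast
    show "\<phi> p \<otimes> a \<in> (\<Union>n. U n)" if "a \<in> (\<Union>n. U n)" for p a using submodD(5)[OF sub] that by blast
  qed
  then obtain ks where ks: "set ks \<subseteq> (\<Union>n. U n)" "(\<Union>n. U n) \<subseteq> span ks" using submod_fg by blast
  have "\<exists>n. set ks \<subseteq> U n" using ks(1)
  proof (induction ks)
    case (Cons k ks)
    then obtain m n where "set ks \<subseteq> U m" "k \<in> U n" by auto
    then have "set (k # ks) \<subseteq> U (max m n)" using mono[of m "max m n"] mono[of n "max m n"] by auto
    then show ?case by blast
  qed auto
  then obtain n where "set ks \<subseteq> U n" by blast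
  then have "(\<Union>n. U n) \<subseteq> U n" using span_subset[OF sub] ks(2) by blast
  moreover have "g [^] n \<in> U (Suc n)"
  proof -
    have "g [^] n = horner g (replicate n 0 @ [1])"
      using g by (simp add: horner_append horner_zeros \<phi>_one)
    then show ?thesis unfolding U_def by force
  qed
  ultimately obtain as where as: "g [^] n = horner g as" "length as = n" by (auto simp: U_def)
  have "horner g (map ((*) (- 1)) as @ [1]) = \<phi> (- 1) \<otimes> g [^] n \<oplus> \<phi> 1 \<otimes> g [^] n"
    using g as by (simp add: horner_append horner_scale \<phi>_one)
  also have "\<dots> = \<zero>" using g \<phi>_minus_cancel[of "g [^] n" 1] by (simp add: a_comm)
  finally show ?thesis by blast
qed

text \<open>A first coefficient \<open>c\<close> outside \<open>C\<close> exists because the leading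
  coefficient \<open>1\<close> of the monic relation is outside. \<open>C\<close> will be the set of
  multiples of some \<open>f\<close>, or \<open>{0}\<close>.\<close>

lemma integral_over_split:
  assumes g: "g \<in> carrier R" and "1 \<notin> C"
  obtains as c bs where "set as \<subseteq> C" "c \<notin> C"
    "horner g as \<oplus> g [^] length as \<otimes> (\<phi> c \<oplus> g \<otimes> horner g bs) = \<zero>"
proof -
  obtain ds where ds: "horner g (ds @ [1]) = \<zero>" using integral_over[OF g] by blast
  have "\<exists>c\<in>set (ds @ [1]). c \<notin> C" using assms by auto
  then obtain as c bs where "ds @ [1] = as @ c # bs" "c \<notin> C" "\<forall>a\<in>set as. \<not> a \<notin> C"
    using split_list_first_prop[of "ds @ [1]" "\<lambda>c. c \<notin> C"] by blast
  then show thesis using ds g that[of as c bs] by (auto simp: horner_append)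
qed

section \<open>Maximal ideals and their contractions to the Euclidean ring\<close>

context
  fixes M
  assumes M: "maximalideal M R"
begin

interpretation M: maximalideal M R by (rule M)
interpretation MP: primeideal M R by (rule maximalideal_prime[OF M])

lemma one_notin_M: "\<one> \<notin> M"
  using M.one_imp_carrier M.I_notcarr by auto

text \<open>If a nonzero nonunit \<open>x\<close> has its image outside \<open>M\<close>, this image
  has an inverse \<open>y\<close> modulo \<open>M\<close>. Multiplying a monic relation of
  \<open>y\<close> by a power of \<open>x\<close> yields an element \<open>1 + x * b\<close> of the
  contraction, which is not zero because \<open>x\<close> is no unit.\<close>

lemma contraction_nonzero: "\<exists>f. f \<noteq> 0 \<and> \<phi> f \<in> M"
proof -
  obtain x :: 'p where x: "x \<noteq> 0" "\<not> x dvd 1" using nonunit_exists by blast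
  show ?thesis
  proof (cases "\<phi> x \<in> M")
    case True
    then show ?thesis using x by blast
  next
    case False
    then obtain q y where qy: "q \<in> M" "y \<in> carrier R" "\<one> = q \<oplus> y \<otimes> \<phi> x"
      using maximalideal_one_decomp[OF M, of "\<phi> x"] by auto
    note [simp] = M.Icarr[OF qy(1)] qy(2)
    define m where "m = \<ominus> q"
    have m: "m \<in> M" using qy by (simp add: m_def)
    note [simp] = M.Icarr[OF m]
    have "\<ominus> q \<oplus> (q \<oplus> y \<otimes> \<phi> x) = y \<otimes> \<phi> x" by (simp add: a_assoc[symmetric] l_neg)
    then have xy: "\<phi> x \<otimes> y = \<one> \<oplus> m"
      using qy(3) by (simp add: m_def m_comm a_comm)
    \<comment> \<open>Each \<open>y\<close> is absorbed by one factor \<open>x\<close>. The leading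
      term has as many of either and becomes \<open>1\<close> modulo \<open>M\<close>; every other
      term keeps a factor \<open>x\<close>, and these are collected in \<open>x * b\<close>.\<close>
    have "\<exists>b. \<exists>k\<in>M. \<phi> (x ^ length as) \<otimes> horner y (as @ [1]) = \<phi> (1 + x * b) \<oplus> k" for as
    proof (induction as)
      case Nil
      show ?case by (rule exI[of _ 0], rule bexI[of _ \<zero>]) (auto simp: \<phi>_one)
    next
      case (Cons a as)
      let ?H = "horner y (as @ [1])"
      obtain b k where bk: "k \<in> M" "\<phi> (x ^ length as) \<otimes> ?H = \<phi> (1 + x * b) \<oplus> k" using Cons by blast
      note [simp] = M.Icarr[OF bk(1)]
      let ?u = "\<phi> (1 + x * b)" and ?v = "\<phi> (x ^ Suc (length as) * a)"
      have "\<phi> (x ^ length (a # as)) \<otimes> horner y ((a # as) @ [1]) =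
          ?v \<oplus> (\<phi> x \<otimes> y) \<otimes> (\<phi> (x ^ length as) \<otimes> ?H)"
        by (simp add: \<phi>_mult r_distr m_ac)
      also have "\<dots> = ?v \<oplus> ((\<one> \<oplus> m) \<otimes> (?u \<oplus> k))"
        by (simp add: xy bk(2))
      also have "\<dots> = (?u \<oplus> ?v) \<oplus> (k \<oplus> m \<otimes> (?u \<oplus> k))"
        by (simp add: l_distr a_ac)
      also have "?u \<oplus> ?v = \<phi> (1 + x * (b + x ^ length as * a))"
        by (simp add: algebra_simps flip: \<phi>_add)
      finally have eq: "\<phi> (x ^ length (a # as)) \<otimes> horner y ((a # as) @ [1]) =
          \<phi> (1 + x * (b + x ^ length as * a)) \<oplus> (k \<oplus> m \<otimes> (?u \<oplus> k))" .
      have "k \<oplus> m \<otimes> (?u \<oplus> k) \<in> M"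
        by (intro M.a_closed M.I_r_closed m bk(1)) simp
      with eq show ?case by (intro exI bexI)
    qed
    moreover obtain as where "horner y (as @ [1]) = \<zero>" using integral_over[OF qy(2)] by blast
    ultimately obtain b k where bk: "k \<in> M" "\<zero> = \<phi> (1 + x * b) \<oplus> k"
      by (metis \<phi>_closed r_null)
    have "\<phi> (1 + x * b) = \<ominus> k" using bk M.Icarr by (metis \<phi>_closed minus_equality)
    then have "\<phi> (1 + x * b) \<in> M" using bk by simp
    moreover have "1 + x * b \<noteq> 0"
    proof
      assume "1 + x * b = 0"
      then have "1 = x * (- b)" by (simp add: eq_neg_iff_add_eq_0)
      then show False using x(2) by (metis dvd_triv_left)
    qed
    ultimately show ?thesis by blast
  qed
qed

text \<open>Division with remainder by a nonzero element of least Euclidean size in the contraction.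
  It is no unit because \<open>M\<close> is proper.\<close>

lemma contraction_generator:
  obtains f where "f \<noteq> 0" "\<And>p. \<phi> p \<in> M \<longleftrightarrow> f dvd p" "\<not> f dvd 1"
proof -
  obtain f where f: "f \<noteq> 0" "\<phi> f \<in> M"
    and min: "\<And>p. p \<noteq> 0 \<Longrightarrow> \<phi> p \<in> M \<Longrightarrow> euclidean_size f \<le> euclidean_size p"
    using contraction_nonzero ex_has_least_nat[of "\<lambda>p. p \<noteq> 0 \<and> \<phi> p \<in> M" _ euclidean_size] by blast
  have dvd: "\<phi> p \<in> M" if "f dvd p" for p using that f M.I_r_closed by (auto simp: \<phi>_mult)
  have "f dvd p" if "\<phi> p \<in> M" for p
  proof -
    have "p mod f = p + f * (- (p div f))" by (simp add: minus_mult_div_eq_mod)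
    then have "\<phi> (p mod f) = \<phi> p \<oplus> \<phi> f \<otimes> \<phi> (- (p div f))" by (simp only: \<phi>_add \<phi>_mult)
    then have "\<phi> (p mod f) \<in> M" using that f M.I_r_closed by simp
    then have "p mod f = 0" using min[of "p mod f"] mod_size_less[OF f(1), of p] by linarith
    then show ?thesis by auto
  qed
  moreover have "\<not> f dvd 1" using dvd[of 1] one_notin_M by (auto simp: \<phi>_one)
  ultimately show thesis using that dvd f by blast
qed

text \<open>The parameter is \<open>\<phi> f\<close> for a generator \<open>f\<close> of the
  contraction of \<open>M\<close>; it is a nonzerodivisor because \<open>R\<close> is
  torsion-free.\<close>

lemma parameter_exists:
  obtains y where "y \<in> M" "\<And>z. z \<in> carrier R \<Longrightarrow> y \<otimes> z = \<zero> \<Longrightarrow> z = \<zero>"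
    "\<And>g. g \<in> M \<Longrightarrow> \<exists>(i::nat). \<exists>s\<in>carrier R - M. \<exists>z\<in>carrier R. s \<otimes> g [^] i = y \<otimes> z"
    "\<And>g. g \<in> carrier R \<Longrightarrow> \<exists>(i::nat) (k::nat). \<exists>s\<in>carrier R - M. \<exists>z\<in>carrier R.
      s \<otimes> (y [^] k \<otimes> g [^] i) = g [^] i \<otimes> (g \<otimes> z)"
proof -
  obtain f where f: "f \<noteq> 0" "\<And>p. \<phi> p \<in> M \<longleftrightarrow> f dvd p" "\<not> f dvd 1" by (rule contraction_generator) blast
  have neg: "v = \<ominus> u" if "u \<oplus> v = \<zero>" "u \<in> carrier R" "v \<in> carrier R" for u v
    using that by (metis a_comm minus_equality)
  show thesis
  proof (rule that[of "\<phi> f"])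
    show "\<phi> f \<in> M" using f by simp
    show "z = \<zero>" if "z \<in> carrier R" "\<phi> f \<otimes> z = \<zero>" for z using torsion_free that f(1) by blast
  next
    fix g assume g: "g \<in> M"
    then have gc: "g \<in> carrier R" using M.Icarr by auto
    \<comment> \<open>The head of the relation is a multiple of \<open>\<phi> f\<close>. The
      cofactor of \<open>g [^] length as\<close> differs from \<open>\<phi> c\<close> by a multiple
      of \<open>g\<close>; as \<open>g\<close> is in \<open>M\<close> and \<open>\<phi> c\<close> is
      not, the cofactor serves as \<open>s\<close>.\<close>
    obtain as c bs where split: "set as \<subseteq> {p. f dvd p}" "\<not> f dvd c"
      "horner g as \<oplus> g [^] length as \<otimes> (\<phi> c \<oplus> g \<otimes> horner g bs) = \<zero>"
      using integral_over_split[OF gc, of "{p. f dvd p}"] f(3) by auto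
    have "\<exists>z\<in>carrier R. horner g as = \<phi> f \<otimes> z" using split(1)
    proof (induction as)
      case Nil
      show ?case by (rule bexI[of _ \<zero>]) auto
    next
      case (Cons a as)
      then obtain z b where "z \<in> carrier R" "horner g as = \<phi> f \<otimes> z" "a = f * b"
        by (auto elim!: dvdE)
      then show ?case using gc
        by (intro bexI[of _ "\<phi> b \<oplus> g \<otimes> z"]) (auto simp: \<phi>_mult r_distr m_lcomm)
    qed
    then obtain z where z: "z \<in> carrier R" "horner g as = \<phi> f \<otimes> z" by blast
    let ?s = "\<phi> c \<oplus> g \<otimes> horner g bs"
    have "?s \<notin> M"
    proof
      assume "?s \<in> M"
      then have "?s \<ominus> g \<otimes> horner g bs \<in> M" using g gc by (simp add: a_minus_def M.I_r_closed)
      moreover have "?s \<ominus> g \<otimes> horner g bs = \<phi> c" using gc by (simp add: a_minus_def a_assoc r_neg)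
      ultimately show False using split f(2) by simp
    qed
    moreover have "?s \<otimes> g [^] length as = \<phi> f \<otimes> (\<ominus> z)"
      using neg[OF split(3)] gc z by (simp add: m_comm r_minus)
    ultimately show "\<exists>(i::nat). \<exists>s\<in>carrier R - M. \<exists>z\<in>carrier R. s \<otimes> g [^] i = \<phi> f \<otimes> z"
      using gc z by (intro exI[of _ "length as"] bexI[of _ ?s] bexI[of _ "\<ominus> z"]) auto
  next
    fix g assume g: "g \<in> carrier R"
    \<comment> \<open>Now the head vanishes, and the relation expresses \<open>\<phi> c\<close>
      times a power of \<open>g\<close> by the next power.\<close>
    obtain as c bs where split: "set as \<subseteq> {0}" "c \<noteq> 0"
      "horner g as \<oplus> g [^] length as \<otimes> (\<phi> c \<oplus> g \<otimes> horner g bs) = \<zero>"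
      using integral_over_split[OF g, of "{0}"] by auto
    have "horner g as = \<zero>" using split(1) g by (induction as) (auto simp: \<phi>_zero)
    then have "\<phi> c \<otimes> g [^] length as = \<ominus> (g [^] length as \<otimes> (g \<otimes> horner g bs))"
      using split(3) g by (intro neg) (auto simp: r_distr m_comm a_comm)
    then have eq: "\<phi> c \<otimes> g [^] length as = g [^] length as \<otimes> (g \<otimes> \<ominus> horner g bs)"
      using g by (simp add: r_minus)
    \<comment> \<open>The nonzero \<open>c\<close> need not lie outside the contraction, but its
      cofactor \<open>d\<close> does; \<open>\<phi> d\<close> serves as \<open>s\<close>, and
      \<open>k\<close> is the exponent of the parameter.\<close>
    obtain k d where kd: "c = f ^ k * d" "\<not> f dvd d" using exists_power_cofactor[OF f(3) split(2)] by blast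
    have eq': "\<phi> d \<otimes> (\<phi> f [^] k \<otimes> g [^] length as) = g [^] length as \<otimes> (g \<otimes> \<ominus> horner g bs)"
      using g eq by (simp add: kd(1) \<phi>_mult \<phi>_power m_ac)
    have "\<ominus> horner g bs \<in> carrier R" "\<phi> d \<in> carrier R - M" using g kd(2) f(2) by simp_all
    then show "\<exists>(i::nat) (k::nat). \<exists>s\<in>carrier R - M. \<exists>z\<in>carrier R.
        s \<otimes> (\<phi> f [^] k \<otimes> g [^] i) = g [^] i \<otimes> (g \<otimes> z)"
      using eq' by blast
  qed
qed

lemma localization_cohen_macaulay: "cohen_macaulay_local (localization R (carrier R - M))"
proof -
  define S where "S = carrier R - M"
  interpret localization_at_prime M R S
    using MP.I_prime one_notin_M by unfold_locales (auto simp: S_def)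
  obtain y where y: "y \<in> M" "\<And>z. z \<in> carrier R \<Longrightarrow> y \<otimes> z = \<zero> \<Longrightarrow> z = \<zero>"
    and power_in_parameter: "\<And>g. g \<in> M \<Longrightarrow> \<exists>(i::nat). \<exists>s\<in>S. \<exists>z\<in>carrier R. s \<otimes> g [^] i = y \<otimes> z"
    and relation: "\<And>g. g \<in> carrier R \<Longrightarrow> \<exists>(i::nat) (k::nat). \<exists>s\<in>S. \<exists>z\<in>carrier R.
      s \<otimes> (y [^] k \<otimes> g [^] i) = g [^] i \<otimes> (g \<otimes> z)"
    unfolding S_def by (rule parameter_exists) blast
  have "cohen_macaulay_local (localization R S)"
    by (rule cohen_macaulay_localI[OF noetherian y power_in_parameter relation])
  then show ?thesis by (simp add: S_def)
qed

end

theorem cohen_macaulay: "cohen_macaulay R"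
  using noetherian localization_cohen_macaulay is_cring by (simp add: cohen_macaulay_def)

end

lemma finite_torsion_free_algebra_iso:
  assumes "finite_torsion_free_algebra R \<phi> B" and h: "h \<in> ring_iso R T" and h0: "h \<zero>\<^bsub>R\<^esub> = \<zero>\<^bsub>T\<^esub>"
  shows "finite_torsion_free_algebra T (h \<circ> \<phi>) (h ` B)"
proof -
  interpret finite_torsion_free_algebra R \<phi> B by fact
  have "cring (T\<lparr>zero := h \<zero>\<^bsub>R\<^esub>\<rparr>)" by (rule ring_iso_imp_img_cring[OF h])
  then have cring_T: "cring T" by (simp add: h0)
  interpret T: cring T by (rule cring_T)
  note hE = ring_iso_memE[OF h]
  have inj: "h a = h b \<Longrightarrow> a = b" if "a \<in> carrier R" "b \<in> carrier R" for a b
    using hE(5) that by (auto simp: bij_betw_def inj_on_def)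
  have surj: "\<exists>a\<in>carrier R. g = h a" if "g \<in> carrier T" for g
    using hE(5) that by (auto simp: bij_betw_def)
  show ?thesis
  proof (intro finite_torsion_free_algebra.intro[OF cring_T] finite_torsion_free_algebra_axioms.intro)
    fix g p assume g: "g \<in> carrier T" "(h \<circ> \<phi>) p \<otimes>\<^bsub>T\<^esub> g = \<zero>\<^bsub>T\<^esub>" "p \<noteq> 0"
    obtain a where a: "a \<in> carrier R" "g = h a" using surj[OF g(1)] by blast
    then have "h (\<phi> p \<otimes>\<^bsub>R\<^esub> a) = h \<zero>\<^bsub>R\<^esub>" using g(2) by (simp add: hE(2) h0)
    then have "\<phi> p \<otimes>\<^bsub>R\<^esub> a = \<zero>\<^bsub>R\<^esub>" using inj a by simp
    then show "g = \<zero>\<^bsub>T\<^esub>" using torsion_free[OF a(1) _ g(3)] a h0 by simp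
  next
    fix S g assume S: "h ` B \<subseteq> S" "\<zero>\<^bsub>T\<^esub> \<in> S" "\<And>a b. a \<in> S \<Longrightarrow> b \<in> S \<Longrightarrow> a \<oplus>\<^bsub>T\<^esub> b \<in> S"
      "\<And>p a. a \<in> S \<Longrightarrow> (h \<circ> \<phi>) p \<otimes>\<^bsub>T\<^esub> a \<in> S" and g: "g \<in> carrier T"
    obtain a where a: "a \<in> carrier R" "g = h a" using surj[OF g(1)] by blast
    have "a \<in> {a \<in> carrier R. h a \<in> S}"
      by (rule B_generates) (use S B_closed a(1) h0 hE(2,3) in auto)
    then show "g \<in> S" using a by simp
  qed (use hE(1-4) finite_B B_closed nonunit_exists in \<open>auto simp: \<phi>_add \<phi>_mult \<phi>_one\<close>)
qed

section \<open>The tangent cone of a monomial ring\<close>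

locale monomial_ring =
  fixes ms :: "nat list" and R :: "'k::field fps ring"
  assumes pos: "\<forall>m\<in>set ms. 0 < m"
    and R_def: "R = monomial_series_ring ms"
begin

section \<open>Orders of the elements of the semigroup\<close>

abbreviation \<Gamma> where "\<Gamma> \<equiv> numerical_semigroup ms"

definition deg :: "nat list \<Rightarrow> nat" where "deg a = (\<Sum>i<length ms. a ! i)"

definition factorizations where "factorizations s = {a. length a = length ms \<and> weight ms a = s}"

text \<open>Outside \<open>\<Gamma>\<close> this is \<open>Max {}\<close>, so only the values on
  \<open>\<Gamma>\<close> carry information.\<close>

definition ord :: "nat \<Rightarrow> nat" where "ord s = Max (deg ` factorizations s)"

lemma finite_factorizations: "finite (factorizations s)"
  unfolding factorizations_def by (rule finite_weight[OF pos])

lemma in_\<Gamma>_iff: "s \<in> \<Gamma> \<longleftrightarrow> factorizations s \<noteq> {}"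
  by (auto simp: numerical_semigroup_def factorizations_def)

lemma deg_le_ord: "a \<in> factorizations s \<Longrightarrow> deg a \<le> ord s"
  unfolding ord_def using finite_factorizations by (intro Max_ge) auto

lemma ord_attained: "s \<in> \<Gamma> \<Longrightarrow> \<exists>a\<in>factorizations s. deg a = ord s"
  unfolding ord_def in_\<Gamma>_iff
  using Max_in[of "deg ` factorizations s"] finite_factorizations by fastforce

lemma factorizations_add:
  assumes "a \<in> factorizations s" "b \<in> factorizations t"
  shows "map2 (+) a b \<in> factorizations (s + t)" "deg (map2 (+) a b) = deg a + deg b"
  using assms by (auto simp: factorizations_def weight_def deg_def algebra_simps sum.distrib)

lemma \<Gamma>_add: "s \<in> \<Gamma> \<Longrightarrow> t \<in> \<Gamma> \<Longrightarrow> s + t \<in> \<Gamma>"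
  using factorizations_add by (metis all_not_in_conv in_\<Gamma>_iff)

text \<open>Two longest factorizations combine to one of the sum. Where the inequality is strict,
  the corresponding product in the tangent cone vanishes.\<close>

lemma ord_superadditive:
  assumes "s \<in> \<Gamma>" "t \<in> \<Gamma>"
  shows "ord s + ord t \<le> ord (s + t)"
proof -
  obtain a b where "a \<in> factorizations s" "deg a = ord s" "b \<in> factorizations t" "deg b = ord t"
    using assms ord_attained by blast
  then show ?thesis using factorizations_add[of a s b t] deg_le_ord by metis
qed

lemma deg_le_weight: "a \<in> factorizations s \<Longrightarrow> deg a \<le> s"
  using pos by (auto simp: factorizations_def deg_def weight_def Suc_le_eq intro!: sum_mono)

lemma weight_le_deg: "a \<in> factorizations s \<Longrightarrow> s \<le> deg a * sum_list ms"
  by (auto simp: factorizations_def deg_def weight_def sum_distrib_right intro!: sum_mono elem_le_sum_list)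

lemma zero_\<Gamma>: "0 \<in> \<Gamma>"
proof -
  have "replicate (length ms) 0 \<in> factorizations 0" by (simp add: factorizations_def weight_def)
  then show ?thesis by (auto simp: in_\<Gamma>_iff)
qed

lemma ord_zero: "ord 0 = 0"
  using ord_attained[OF zero_\<Gamma>] deg_le_weight by fastforce

lemma le_ord: "s \<in> \<Gamma> \<Longrightarrow> s \<le> ord s * sum_list ms"
  using ord_attained weight_le_deg by metis

lemma ord_pos: "s \<in> \<Gamma> \<Longrightarrow> s \<noteq> 0 \<Longrightarrow> ord s > 0"
  using le_ord[of s] by (metis gr0I le_zero_eq mult_zero_left)

text \<open>Hence an element of the tangent cone, having finitely many nonzero components, has
  finitely many coefficients altogether and can be represented by a polynomial.\<close>

lemma finite_ord_fibre: "finite {s \<in> \<Gamma>. ord s = n}"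
proof (rule finite_subset)
  show "{s \<in> \<Gamma>. ord s = n} \<subseteq> {..n * sum_list ms}" using le_ord by blast
qed simp

lemma generator_\<Gamma>:
  assumes "m \<in> set ms"
  shows "m \<in> \<Gamma>" "ord m \<ge> 1"
proof -
  obtain i where i: "i < length ms" "m = ms ! i" using assms by (auto simp: in_set_conv_nth)
  let ?a = "(replicate (length ms) 0)[i := 1]"
  have "(\<Sum>j<length ms. ?a ! j * ms ! j) = (\<Sum>j<length ms. if j = i then ms ! i else 0)"
    using i by (intro sum.cong) (auto simp: nth_list_update)
  then have "?a \<in> factorizations m" using i by (simp add: factorizations_def weight_def)
  then show "m \<in> \<Gamma>" by (auto simp: in_\<Gamma>_iff)
  then show "ord m \<ge> 1" using ord_pos[of m] pos assms by force
qed

text \<open>Remove from a longest factorization any generator that occurs in it.\<close>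

lemma ord_Suc_peel:
  assumes "s \<in> \<Gamma>" "ord s \<ge> Suc n"
  shows "\<exists>m\<in>set ms. m \<le> s \<and> s - m \<in> \<Gamma> \<and> ord (s - m) \<ge> n"
proof -
  obtain a where a: "a \<in> factorizations s" "deg a = ord s" using ord_attained[OF assms(1)] by blast
  have "\<exists>i<length ms. a ! i > 0"
  proof (rule ccontr)
    assume "\<not> ?thesis"
    then have "deg a = 0" by (auto simp: deg_def)
    then show False using a assms by simp
  qed
  then obtain i where i: "i < length ms" "a ! i > 0" by blast
  have len: "length a = length ms" using a by (simp add: factorizations_def)
  let ?b = "a[i := a ! i - Suc 0]"
  have upd: "?b ! j = (if j = i then a ! i - Suc 0 else a ! j)" if "j < length ms" for j
    using that len by (simp add: nth_list_update)
  have "deg a = deg ?b + 1"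
    unfolding deg_def using i
    by (simp add: sum.remove[of "{..<length ms}" i] upd)
  moreover have "weight ms a = weight ms ?b + ms ! i"
  proof -
    have "a ! i * ms ! i = (a ! i - Suc 0) * ms ! i + ms ! i"
      using i(2) by (metis Suc_pred add.commute mult_Suc)
    then show ?thesis
      unfolding weight_def using i(1) by (simp add: sum.remove[of "{..<length ms}" i] upd)
  qed
  ultimately have "?b \<in> factorizations (s - ms ! i)" "ms ! i \<le> s" "deg ?b \<ge> n"
    using a assms len by (auto simp: factorizations_def)
  then have "s - ms ! i \<in> \<Gamma>" "ord (s - ms ! i) \<ge> n"
    using deg_le_ord[of ?b "s - ms ! i"] by (auto simp: in_\<Gamma>_iff)
  then show ?thesis using i(1) \<open>ms ! i \<le> s\<close> by (meson nth_mem)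
qed

section \<open>The filtration by order and the powers of the maximal ideal\<close>

definition filt :: "nat \<Rightarrow> 'k fps set" where
  "filt n = {f. \<forall>s. fps_nth f s \<noteq> 0 \<longrightarrow> s \<in> \<Gamma> \<and> n \<le> ord s}"

lemma R_simps: "mult R = (*)" "one R = 1" "zero R = 0" "add R = (+)"
  by (simp_all add: R_def monomial_series_ring_def)

lemma carrier_R: "carrier R = filt 0"
  unfolding R_def carrier_monomial_series_ring[OF pos] filt_def by simp

lemma filt_zero: "0 \<in> filt n"
  by (simp add: filt_def)

lemma filt_add:
  assumes "f \<in> filt n" "g \<in> filt n"
  shows "f + g \<in> filt n"
proof -
  have "fps_nth f s \<noteq> 0 \<or> fps_nth g s \<noteq> 0" if "fps_nth (f + g) s \<noteq> 0" for s using that by auto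
  then show ?thesis using assms by (auto simp: filt_def)
qed

lemma filt_uminus: "f \<in> filt n \<Longrightarrow> - f \<in> filt n"
  by (simp add: filt_def)

lemma filt_mult:
  assumes "f \<in> filt m" "g \<in> filt n"
  shows "f * g \<in> filt (m + n)"
  unfolding filt_def
proof (rule CollectI, intro allI impI)
  fix s assume "fps_nth (f * g) s \<noteq> 0"
  then have "(\<Sum>i=0..s. fps_nth f i * fps_nth g (s - i)) \<noteq> 0" by (simp add: fps_mult_nth)
  then obtain i where i: "i \<in> {0..s}" "fps_nth f i * fps_nth g (s - i) \<noteq> 0"
    by (rule sum.not_neutral_contains_not_neutral)
  then have "i \<in> \<Gamma>" "s - i \<in> \<Gamma>" "m \<le> ord i" "n \<le> ord (s - i)" using assms by (auto simp: filt_def)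
  then show "s \<in> \<Gamma> \<and> m + n \<le> ord s"
    using \<Gamma>_add[of i "s - i"] ord_superadditive[of i "s - i"] i(1) by auto
qed

lemma filt_antimono: "m \<le> n \<Longrightarrow> filt n \<subseteq> filt m"
  by (auto simp: filt_def)

lemma filt_one: "1 \<in> filt 0"
  using zero_\<Gamma> by (auto simp: filt_def)

lemma cring_R: "cring R"
proof (rule cringI)
  show "abelian_group R"
  proof (rule abelian_groupI)
    show "\<exists>y\<in>carrier R. y \<oplus>\<^bsub>R\<^esub> x = \<zero>\<^bsub>R\<^esub>" if "x \<in> carrier R" for x
      using that filt_uminus by (intro bexI[of _ "- x"]) (auto simp: carrier_R R_simps)
  qed (auto simp: carrier_R R_simps filt_add filt_zero)
  show "comm_monoid R"
    by (rule comm_monoidI) (use filt_mult[of _ 0 _ 0] filt_one in \<open>auto simp: carrier_R R_simps mult_ac\<close>)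
qed (simp add: R_simps algebra_simps)

sublocale cring R by (rule cring_R)

lemma a_inv_R: "f \<in> carrier R \<Longrightarrow> \<ominus>\<^bsub>R\<^esub> f = - f"
  by (rule minus_equality) (auto simp: R_simps carrier_R filt_uminus)

lemma ideal_filt: "ideal (filt n) R"
proof (rule idealI[OF ring_axioms])
  show "subgroup (filt n) (add_monoid R)"
  proof (rule subgroup.intro)
    show "filt n \<subseteq> carrier (add_monoid R)" using filt_antimono[of 0 n] by (simp add: carrier_R)
    show "inv\<^bsub>add_monoid R\<^esub> f \<in> filt n" if "f \<in> filt n" for f
      using that a_inv_R[of f] filt_antimono[of 0 n] filt_uminus by (auto simp: a_inv_def carrier_R)
  qed (auto simp: R_simps filt_add filt_zero)
qed (use filt_mult[of _ n _ 0] filt_mult[of _ 0 _ n] in \<open>auto simp: carrier_R R_simps\<close>)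

text \<open>By the recursion for the coefficients of the inverse, a positive exponent in its support
  is the sum of an exponent of \<open>f\<close> and a smaller exponent of the inverse; induction
  puts both into \<open>\<Gamma>\<close>.\<close>

lemma inverse_in_carrier:
  assumes f: "f \<in> carrier R" "fps_nth f 0 \<noteq> 0"
  shows "inverse f \<in> carrier R"
proof -
  have "s \<in> \<Gamma>" if "fps_nth (inverse f) s \<noteq> 0" for s
    using that
  proof (induction s rule: less_induct)
    case (less s)
    show ?case
    proof (cases "s = 0")
      case False
      have "fps_nth (f * inverse f) s = 0" using f(2) False by (simp add: inverse_mult_eq_1')
      then have "fps_nth f 0 * fps_nth (inverse f) s + (\<Sum>i=Suc 0..s. fps_nth f i * fps_nth (inverse f) (s - i)) = 0"
        by (simp add: fps_mult_nth sum.atLeast_Suc_atMost)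
      then have "(\<Sum>i=Suc 0..s. fps_nth f i * fps_nth (inverse f) (s - i)) \<noteq> 0" using f(2) less.prems by auto
      then obtain i where i: "i \<in> {Suc 0..s}" "fps_nth f i * fps_nth (inverse f) (s - i) \<noteq> 0"
        by (rule sum.not_neutral_contains_not_neutral)
      then have "i \<in> \<Gamma>" using f(1) by (auto simp: carrier_R filt_def)
      moreover have "s - i \<in> \<Gamma>" using i by (intro less.IH) auto
      ultimately show ?thesis using \<Gamma>_add[of i "s - i"] i(1) by simp
    qed (simp add: zero_\<Gamma>)
  qed
  then show ?thesis by (simp add: carrier_R filt_def)
qed

text \<open>A series in \<open>R\<close> with nonzero constant term is a unit of \<open>R\<close>,
  so every proper ideal lies in \<open>filt 1\<close>.\<close>

lemma maximalideal_R:
  assumes "maximalideal I R"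
  shows "I = filt 1"
proof -
  interpret I: maximalideal I R by fact
  have "I \<subseteq> filt 1"
  proof
    fix f assume f: "f \<in> I"
    have "fps_nth f 0 = 0"
    proof (rule ccontr)
      assume nz: "fps_nth f 0 \<noteq> 0"
      have "f \<otimes>\<^bsub>R\<^esub> inverse f \<in> I" using f inverse_in_carrier[OF I.Icarr[OF f] nz] by (rule I.I_r_closed)
      then have "\<one>\<^bsub>R\<^esub> \<in> I" using nz by (simp add: R_simps inverse_mult_eq_1')
      then show False using I.one_imp_carrier I.I_notcarr by simp
    qed
    then have "s \<in> \<Gamma> \<and> 1 \<le> ord s" if "fps_nth f s \<noteq> 0" for s
      using that I.Icarr[OF f] ord_pos[of s] unfolding carrier_R filt_def by (cases "s = 0") auto
    then show "f \<in> filt 1" by (simp add: filt_def)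
  qed
  moreover have "1 \<notin> filt 1" using ord_zero by (auto simp: filt_def intro!: exI[of _ 0])
  then have "filt 1 \<noteq> carrier R" using filt_one carrier_R by auto
  ultimately show ?thesis
    using I.I_maximal[OF ideal_filt[of 1]] filt_antimono[of 0 1] by (auto simp: carrier_R)
qed

lemma ideal_prod_zero: "\<zero>\<^bsub>R\<^esub> \<in> filt m \<cdot>\<^bsub>R\<^esub> filt n"
  using ideal_prod.prod[of 0 "filt m" 0 "filt n" R] filt_zero by (simp add: R_simps)

text \<open>A series has infinitely many terms, but there are finitely many generators. Choose for
  each exponent \<open>s\<close> of \<open>f\<close> a generator \<open>\<mu> s\<close> to split off
  and group the terms by it: \<open>f\<close> is the finite sum of the
  \<open>g m * fps_X ^ m\<close>, with each \<open>g m\<close> in \<open>filt n\<close>.\<close>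

lemma ideal_prod_filt: "filt n \<cdot>\<^bsub>R\<^esub> filt 1 = filt (Suc n)"
proof
  show "filt n \<cdot>\<^bsub>R\<^esub> filt 1 \<subseteq> filt (Suc n)"
  proof
    fix f assume "f \<in> filt n \<cdot>\<^bsub>R\<^esub> filt 1"
    then show "f \<in> filt (Suc n)"
      by (induction rule: ideal_prod.induct) (use filt_mult[of _ n _ 1] filt_add in \<open>auto simp: R_simps\<close>)
  qed
  show "filt (Suc n) \<subseteq> filt n \<cdot>\<^bsub>R\<^esub> filt 1"
  proof
    fix f assume f: "f \<in> filt (Suc n)"
    obtain \<mu> where \<mu>: "\<And>s. s \<in> \<Gamma> \<Longrightarrow> ord s \<ge> Suc n \<Longrightarrow>
        \<mu> s \<in> set ms \<and> \<mu> s \<le> s \<and> s - \<mu> s \<in> \<Gamma> \<and> ord (s - \<mu> s) \<ge> n"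
      using ord_Suc_peel[of _ n] by metis
    define g where "g m = Abs_fps (\<lambda>t. if \<mu> (t + m) = m then fps_nth f (t + m) else 0)" for m
    have g: "g m \<in> filt n" for m
      unfolding filt_def
    proof (rule CollectI, intro allI impI)
      fix t assume "fps_nth (g m) t \<noteq> 0"
      then have "\<mu> (t + m) = m" "fps_nth f (t + m) \<noteq> 0" by (auto simp: g_def split: if_splits)
      then show "t \<in> \<Gamma> \<and> n \<le> ord t" using \<mu>[of "t + m"] f by (auto simp: filt_def)
    qed
    have "f = (\<Sum>m\<in>set ms. g m * fps_X ^ m)"
    proof (rule fps_ext)
      fix s
      have "fps_nth (\<Sum>m\<in>set ms. g m * fps_X ^ m) s = (\<Sum>m\<in>set ms. if m = \<mu> s then fps_nth f s else 0)"
        unfolding fps_sum_nth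
      proof (rule sum.cong)
        fix m assume "m \<in> set ms"
        show "fps_nth (g m * fps_X ^ m) s = (if m = \<mu> s then fps_nth f s else 0)"
        proof (cases "fps_nth f s = 0")
          case False
          then have "\<mu> s \<le> s" using \<mu>[of s] f by (auto simp: filt_def)
          then show ?thesis by (auto simp: fps_X_power_mult_right_nth g_def)
        qed (auto simp: fps_X_power_mult_right_nth g_def)
      qed simp
      also have "\<dots> = fps_nth f s"
        using \<mu>[of s] f by (cases "fps_nth f s = 0") (auto simp: filt_def)
      finally show "fps_nth f s = fps_nth (\<Sum>m\<in>set ms. g m * fps_X ^ m) s" ..
    qed
    moreover have "(\<Sum>m\<in>A. g m * fps_X ^ m) \<in> filt n \<cdot>\<^bsub>R\<^esub> filt 1" if "finite A" "A \<subseteq> set ms" for A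
      using that
    proof (induction A rule: finite_induct)
      case empty
      then show ?case using ideal_prod_zero by (simp add: R_simps)
    next
      case (insert m A)
      have "fps_X ^ m \<in> filt 1" using insert generator_\<Gamma>[of m] by (auto simp: filt_def)
      then have "g m * fps_X ^ m \<in> filt n \<cdot>\<^bsub>R\<^esub> filt 1"
        using ideal_prod.prod[OF g, of "fps_X ^ m" "filt 1" R m] by (simp add: R_simps)
      then show ?case using insert ideal_prod.sum[of "g m * fps_X ^ m" R "filt n" "filt 1"]
        by (simp add: R_simps)
    qed
    ultimately show "f \<in> filt n \<cdot>\<^bsub>R\<^esub> filt 1" by simp
  qed
qed

lemma ideal_power_filt: "ideal_power R (filt 1) n = filt n"
proof (induction n)
  case (Suc n)
  then show ?case using ideal_prod_filt by (simp add: ideals_set_def nat_pow_def)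
qed (simp add: ideals_set_def nat_pow_def carrier_R)

end

section \<open>A model of the tangent cone on polynomials\<close>

context monomial_ring
begin

text \<open>A polynomial \<open>c\<close> stands for the combination of the basis elements
  \<open>e_s\<close> with coefficients \<open>coeff c s\<close>. The condition on orders drops the
  pairs whose product is zero.\<close>

definition graded_coeff :: "'k poly \<Rightarrow> 'k poly \<Rightarrow> nat \<Rightarrow> 'k" where
  "graded_coeff c d u = (\<Sum>i=0..u. if ord i + ord (u - i) = ord u then coeff c i * coeff d (u - i) else 0)"

definition graded_mult :: "'k poly \<Rightarrow> 'k poly \<Rightarrow> 'k poly" where
  "graded_mult c d = Abs_poly (graded_coeff c d)"

definition graded_model :: "'k poly ring" where
  "graded_model = \<lparr>carrier = {c. \<forall>s. coeff c s \<noteq> 0 \<longrightarrow> s \<in> \<Gamma>},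
     mult = graded_mult, one = 1, zero = 0, add = (+)\<rparr>"

lemma graded_model_simps:
  "mult graded_model = graded_mult" "one graded_model = 1" "zero graded_model = 0" "add graded_model = (+)"
  by (simp_all add: graded_model_def)

lemma carrier_model: "c \<in> carrier graded_model \<longleftrightarrow> (\<forall>s. coeff c s \<noteq> 0 \<longrightarrow> s \<in> \<Gamma>)"
  by (simp add: graded_model_def)

text \<open>\<open>Abs_poly\<close> keeps the coefficients only of functions that vanish from some
  index on, here above \<open>degree c + degree d\<close>.\<close>

lemma coeff_graded_mult: "coeff (graded_mult c d) u = graded_coeff c d u"
proof -
  have "graded_coeff c d u = 0" if "u > degree c + degree d" for u
    unfolding graded_coeff_def
  proof (rule sum.neutral, clarify)
    fix i
    have "degree c < i \<or> degree d < u - i" using that by linarith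
    then show "(if ord i + ord (u - i) = ord u then coeff c i * coeff d (u - i) else 0) = 0"
      by (auto simp: coeff_eq_0)
  qed
  then show ?thesis unfolding graded_mult_def by (subst coeff_Abs_poly) auto
qed

lemma graded_mult_closed:
  assumes "c \<in> carrier graded_model" "d \<in> carrier graded_model"
  shows "graded_mult c d \<in> carrier graded_model"
  unfolding carrier_model
proof (intro allI impI)
  fix u assume "coeff (graded_mult c d) u \<noteq> 0"
  then obtain i where i: "i \<in> {0..u}" "(if ord i + ord (u - i) = ord u then coeff c i * coeff d (u - i) else 0) \<noteq> 0"
    unfolding coeff_graded_mult graded_coeff_def by (rule sum.not_neutral_contains_not_neutral)
  then have "coeff c i \<noteq> 0" "coeff d (u - i) \<noteq> 0" by (auto split: if_splits)
  then have "i \<in> \<Gamma>" "u - i \<in> \<Gamma>" using assms by (auto simp: carrier_model)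
  then show "u \<in> \<Gamma>" using \<Gamma>_add[of i "u - i"] i(1) by simp
qed

lemma graded_mult_commute: "graded_mult c d = graded_mult d c"
proof (rule poly_eqI)
  fix u
  show "coeff (graded_mult c d) u = coeff (graded_mult d c) u"
    unfolding coeff_graded_mult graded_coeff_def
    by (subst fps_mult_commute_lemma) (auto intro!: sum.cong simp: add.commute mult.commute)
qed

text \<open>Both sides are sums over triples with \<open>ord i + ord j + ord k = ord u\<close>. By
  superadditivity this single equation holds exactly when the two successive products in either
  bracketing are nonzero.\<close>

lemma graded_mult_assoc:
  assumes c: "c \<in> carrier graded_model" and d: "d \<in> carrier graded_model" and e: "e \<in> carrier graded_model"
  shows "graded_mult (graded_mult c d) e = graded_mult c (graded_mult d e)"
proof (rule poly_eqI)
  fix u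
  let ?f = "\<lambda>i j k. if ord i + ord j + ord k = ord u then coeff c i * coeff d j * coeff e k else 0"
  have eq1: "(if ord j + ord (u - j) = ord u then graded_coeff c d j * coeff e (u - j) else 0) =
      (\<Sum>i=0..j. ?f i (j - i) (u - j))" if j: "j \<le> u" for j
  proof -
    have "(if ord j + ord (u - j) = ord u then
          (if ord i + ord (j - i) = ord j then coeff c i * coeff d (j - i) else 0) * coeff e (u - j) else 0) =
        ?f i (j - i) (u - j)" if i: "i \<le> j" for i
    proof (cases "coeff c i * coeff d (j - i) * coeff e (u - j) = 0")
      case False
      then have G: "i \<in> \<Gamma>" "j - i \<in> \<Gamma>" "u - j \<in> \<Gamma>" using c d e by (auto simp: carrier_model)
      then have "j \<in> \<Gamma>" using \<Gamma>_add[of i "j - i"] i by simp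
      then have "ord i + ord (j - i) \<le> ord j" "ord j + ord (u - j) \<le> ord u"
        using ord_superadditive[of i "j - i"] ord_superadditive[of j "u - j"] G i j by auto
      then show ?thesis by auto
    qed auto
    then show ?thesis
      unfolding graded_coeff_def
      by (cases "ord j + ord (u - j) = ord u") (auto simp: sum_distrib_right intro!: sum.cong)
  qed
  have eq2: "(if ord i + ord (u - i) = ord u then coeff c i * graded_coeff d e (u - i) else 0) =
      (\<Sum>j=0..u - i. ?f i j (u - i - j))" if i: "i \<le> u" for i
  proof -
    have "(if ord i + ord (u - i) = ord u then
          coeff c i * (if ord j + ord (u - i - j) = ord (u - i) then coeff d j * coeff e (u - i - j) else 0) else 0) =
        ?f i j (u - i - j)" if j: "j \<le> u - i" for j
    proof (cases "coeff c i * coeff d j * coeff e (u - i - j) = 0")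
      case False
      then have G: "i \<in> \<Gamma>" "j \<in> \<Gamma>" "u - i - j \<in> \<Gamma>" using c d e by (auto simp: carrier_model)
      have "j + (u - i - j) = u - i" using j by simp
      then have "u - i \<in> \<Gamma>" using \<Gamma>_add[OF G(2,3)] by simp
      then have "ord j + ord (u - i - j) \<le> ord (u - i)" "ord i + ord (u - i) \<le> ord u"
        using ord_superadditive[of j "u - i - j"] ord_superadditive[of i "u - i"] G i j by auto
      then show ?thesis by (auto simp: mult.assoc)
    qed auto
    then show ?thesis
      unfolding graded_coeff_def
      by (cases "ord i + ord (u - i) = ord u") (auto simp: sum_distrib_left intro!: sum.cong)
  qed
  have "coeff (graded_mult (graded_mult c d) e) u = (\<Sum>j=0..u. \<Sum>i=0..j. ?f i (j - i) (u - j))"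
    unfolding coeff_graded_mult graded_coeff_def[of _ _ u]
    by (rule sum.cong) (use eq1 in auto)
  also have "\<dots> = (\<Sum>j=0..u. \<Sum>i=0..u - j. ?f j i (u - j - i))"
    by (rule fps_mult_assoc_lemma)
  also have "\<dots> = coeff (graded_mult c (graded_mult d e)) u"
    unfolding coeff_graded_mult graded_coeff_def[of _ _ u]
    by (rule sum.cong) (use eq2 in auto)
  finally show "coeff (graded_mult (graded_mult c d) e) u = coeff (graded_mult c (graded_mult d e)) u" .
qed

lemma graded_mult_add_left: "graded_mult (c + d) e = graded_mult c e + graded_mult d e"
  by (rule poly_eqI)
    (auto simp: coeff_graded_mult graded_coeff_def algebra_simps simp flip: sum.distrib intro!: sum.cong)

lemma graded_mult_one: "graded_mult 1 c = c"
proof (rule poly_eqI)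
  fix u
  have "graded_coeff 1 c u = (\<Sum>i=0..u. if i = 0 then coeff c u else 0)"
    unfolding graded_coeff_def by (rule sum.cong) (auto simp: ord_zero)
  then show "coeff (graded_mult 1 c) u = coeff c u" by (simp add: coeff_graded_mult)
qed

lemma model_add: "c \<in> carrier graded_model \<Longrightarrow> d \<in> carrier graded_model \<Longrightarrow> c + d \<in> carrier graded_model"
  unfolding carrier_model by (metis add.right_neutral coeff_add)

lemma cring_model: "cring graded_model"
proof (rule cringI)
  show "abelian_group graded_model"
  proof (rule abelian_groupI)
    show "\<exists>y\<in>carrier graded_model. y \<oplus>\<^bsub>graded_model\<^esub> x = \<zero>\<^bsub>graded_model\<^esub>" if "x \<in> carrier graded_model" for x
      using that by (intro bexI[of _ "- x"]) (auto simp: carrier_model graded_model_simps)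
  qed (auto simp: graded_model_simps model_add add_ac, simp add: carrier_model)
  show "comm_monoid graded_model"
  proof (rule comm_monoidI)
    show "\<one>\<^bsub>graded_model\<^esub> \<in> carrier graded_model"
      using zero_\<Gamma> by (auto simp: carrier_model graded_model_simps split: if_splits)
  qed (auto simp: graded_model_simps graded_mult_closed graded_mult_assoc graded_mult_one
      intro: graded_mult_commute)
qed (simp add: graded_model_simps graded_mult_add_left)

text \<open>The homogeneous component of degree \<open>n\<close> of the element of the tangent cone with coefficients
  \<open>c\<close>: the coset of \<open>\<Sum>\<^sub>s c\<^sub>s t^s\<close>, the sum being over the \<open>s\<close> of order \<open>n\<close>.\<close>

definition leading_coset :: "'k poly \<Rightarrow> nat \<Rightarrow> 'k fps set" where
  "leading_coset c n = {g \<in> filt n. \<forall>s\<in>\<Gamma>. ord s = n \<longrightarrow> fps_nth g s = coeff c s}"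

text \<open>The representative supported in order \<open>n\<close> alone; it shows that
  \<open>leading_coset c n\<close> is not empty.\<close>

definition homogeneous_part :: "'k poly \<Rightarrow> nat \<Rightarrow> 'k fps" where
  "homogeneous_part c n = Abs_fps (\<lambda>s. if s \<in> \<Gamma> \<and> ord s = n then coeff c s else 0)"

lemma leading_cosetD:
  assumes "g \<in> leading_coset c n"
  shows "g \<in> filt n" "fps_nth g s \<noteq> 0 \<Longrightarrow> s \<in> \<Gamma> \<and> n \<le> ord s"
    "s \<in> \<Gamma> \<Longrightarrow> ord s = n \<Longrightarrow> fps_nth g s = coeff c s"
proof -
  show "g \<in> filt n" using assms unfolding leading_coset_def by blast
  then show "s \<in> \<Gamma> \<and> n \<le> ord s" if "fps_nth g s \<noteq> 0" using that unfolding filt_def by blast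
  show "fps_nth g s = coeff c s" if "s \<in> \<Gamma>" "ord s = n" using assms that unfolding leading_coset_def by blast
qed

lemma homogeneous_part_in: "homogeneous_part c n \<in> leading_coset c n"
  by (auto simp: homogeneous_part_def leading_coset_def filt_def split: if_splits)

lemma rcoset_R: "I +>\<^bsub>R\<^esub> x = {y + x |y. y \<in> I}"
  by (auto simp: a_r_coset_def r_coset_def R_simps)

text \<open>Two members agree on the exponents of order \<open>n\<close>, so their difference has
  order at least \<open>Suc n\<close>.\<close>

lemma rcoset_filt_eq: "g \<in> leading_coset c n \<Longrightarrow> filt (Suc n) +>\<^bsub>R\<^esub> g = leading_coset c n"
proof (intro Set.set_eqI iffI)
  fix f assume g: "g \<in> leading_coset c n" and "f \<in> filt (Suc n) +>\<^bsub>R\<^esub> g"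
  then obtain y where y: "y \<in> filt (Suc n)" "f = y + g" by (auto simp: rcoset_R)
  then have "f \<in> filt n" using g filt_add filt_antimono[of n "Suc n"] by (auto simp: leading_coset_def)
  moreover have "fps_nth y s = 0" if "ord s = n" for s using y(1) that by (auto simp: filt_def)
  ultimately show "f \<in> leading_coset c n" using g y by (auto simp: leading_coset_def)
next
  fix f assume g: "g \<in> leading_coset c n" and f: "f \<in> leading_coset c n"
  have "f + - g \<in> filt n" using leading_cosetD(1)[OF f] filt_uminus[OF leading_cosetD(1)[OF g]] by (rule filt_add)
  moreover have "fps_nth (f - g) s = 0" if "s \<in> \<Gamma>" "ord s = n" for s
    using leading_cosetD(3)[OF f that] leading_cosetD(3)[OF g that] by simp
  ultimately have "s \<in> \<Gamma> \<and> Suc n \<le> ord s" if "fps_nth (f - g) s \<noteq> 0" for s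
    using that unfolding filt_def by (auto simp: Suc_le_eq nat_less_le)
  then have "f - g \<in> filt (Suc n)"
    unfolding filt_def by blast
  then show "f \<in> filt (Suc n) +>\<^bsub>R\<^esub> g"
    unfolding rcoset_R by (intro CollectI exI[of _ "f - g"]) auto
qed

lemma leading_coset_zero: "leading_coset 0 n = filt (Suc n)"
  using rcoset_filt_eq[of 0 0 n] filt_zero by (simp add: rcoset_R leading_coset_def)

section \<open>Leading cosets as an isomorphism onto the tangent cone\<close>

definition tangent_cone where "tangent_cone = assoc_graded R (filt 1)"

lemma tangent_cone_simps:
  "carrier tangent_cone = {f. (\<forall>n. f n \<in> (\<lambda>x. filt (Suc n) +>\<^bsub>R\<^esub> x) ` filt n) \<and> finite {n. f n \<noteq> filt (Suc n)}}"
  "f \<otimes>\<^bsub>tangent_cone\<^esub> g = (\<lambda>n. \<Union>a\<in>{a. \<forall>i. a i \<in> f i}. \<Union>b\<in>{b. \<forall>i. b i \<in> g i}.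
      filt (Suc n) +>\<^bsub>R\<^esub> (\<Oplus>\<^bsub>R\<^esub>i\<in>{..n}. a i \<otimes>\<^bsub>R\<^esub> b (n - i)))"
  "\<one>\<^bsub>tangent_cone\<^esub> = (\<lambda>n. filt (Suc n) +>\<^bsub>R\<^esub> (if n = 0 then \<one>\<^bsub>R\<^esub> else \<zero>\<^bsub>R\<^esub>))"
  "\<zero>\<^bsub>tangent_cone\<^esub> = (\<lambda>n. filt (Suc n))"
  "f \<oplus>\<^bsub>tangent_cone\<^esub> g = (\<lambda>n. f n <+>\<^bsub>R\<^esub> g n)"
  unfolding tangent_cone_def assoc_graded_def ideal_power_filt by simp_all

lemma leading_coset_closed: "leading_coset c \<in> carrier tangent_cone"
proof -
  have coset: "leading_coset c n \<in> (\<lambda>x. filt (Suc n) +>\<^bsub>R\<^esub> x) ` filt n" for n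
    using rcoset_filt_eq[OF homogeneous_part_in[of c n]] homogeneous_part_in[of c n]
    unfolding leading_coset_def by blast
  have sub: "{n. leading_coset c n \<noteq> filt (Suc n)} \<subseteq> ord ` {s. coeff c s \<noteq> 0}"
  proof
    fix n assume n: "n \<in> {n. leading_coset c n \<noteq> filt (Suc n)}"
    show "n \<in> ord ` {s. coeff c s \<noteq> 0}"
    proof (rule ccontr)
      assume "n \<notin> ord ` {s. coeff c s \<noteq> 0}"
      then have "leading_coset c n = leading_coset 0 n" by (auto simp: leading_coset_def)
      then show False using n leading_coset_zero by simp
    qed
  qed
  have "finite {s. coeff c s \<noteq> 0}"
    using MOST_coeff_eq_0[of c] by (simp add: eventually_cofinite)
  then have "finite {n. leading_coset c n \<noteq> filt (Suc n)}" by (rule finite_surj[OF _ sub])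
  then show ?thesis unfolding tangent_cone_simps(1) by (intro CollectI conjI allI coset)
qed

lemma finsum_R: "finite A \<Longrightarrow> (\<And>i. i \<in> A \<Longrightarrow> F i \<in> carrier R) \<Longrightarrow> finsum R F A = sum F A"
proof (induction A rule: finite_induct)
  case (insert i A)
  then have "finsum R F (insert i A) = F i \<oplus>\<^bsub>R\<^esub> finsum R F A"
    by (intro finsum_insert) (auto simp: Pi_iff)
  then show ?case using insert by (simp add: R_simps)
qed (simp add: R_simps)

text \<open>Let \<open>u\<close> have order \<open>n\<close>. Since
  \<open>ord s + ord (u - s) \<le> n\<close> while \<open>a i\<close> and \<open>b (n - i)\<close>
  have orders at least \<open>i\<close> and \<open>n - i\<close>, the pair \<open>s\<close>,
  \<open>u - s\<close> contributes only if \<open>i = ord s\<close> and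
  \<open>n - i = ord (u - s)\<close>. There the coefficients are those of \<open>c\<close> and
  \<open>d\<close>.\<close>

lemma leading_coset_mult_mem:
  assumes c: "c \<in> carrier graded_model" and d: "d \<in> carrier graded_model"
    and a: "\<And>i. a i \<in> leading_coset c i" and b: "\<And>i. b i \<in> leading_coset d i"
  shows "(\<Sum>i\<le>n. a i * b (n - i)) \<in> leading_coset (graded_mult c d) n"
proof -
  have a': "fps_nth (a i) s \<noteq> 0 \<Longrightarrow> s \<in> \<Gamma> \<and> i \<le> ord s" and b': "fps_nth (b i) s \<noteq> 0 \<Longrightarrow> s \<in> \<Gamma> \<and> i \<le> ord s"
    for i s using leading_cosetD(2)[OF a] leading_cosetD(2)[OF b] by auto
  have "(\<Sum>i\<in>A. a i * b (n - i)) \<in> filt n" if "A \<subseteq> {..n}" for A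
    using finite_subset[OF that finite_atMost] that
  proof (induction A rule: finite_induct)
    case (insert i A)
    have "a i * b (n - i) \<in> filt n"
      using filt_mult[OF leading_cosetD(1)[OF a[of i]] leading_cosetD(1)[OF b[of "n - i"]]] insert.prems
      by simp
    then show ?case using insert filt_add by auto
  qed (simp add: filt_zero)
  moreover have "fps_nth (\<Sum>i\<le>n. a i * b (n - i)) u = coeff (graded_mult c d) u" if u: "u \<in> \<Gamma>" "ord u = n" for u
  proof -
    have inner: "(\<Sum>i\<le>n. fps_nth (a i) s * fps_nth (b (n - i)) (u - s)) =
        (if ord s + ord (u - s) = ord u then coeff c s * coeff d (u - s) else 0)" if s: "s \<le> u" for s
    proof (cases "s \<in> \<Gamma> \<and> u - s \<in> \<Gamma>")
      case True
      then have le: "ord s + ord (u - s) \<le> n" using ord_superadditive[of s "u - s"] u s by simp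
      have "fps_nth (a i) s * fps_nth (b (n - i)) (u - s) =
          (if i = ord s then (if ord s + ord (u - s) = ord u then coeff c s * coeff d (u - s) else 0) else 0)"
        if i: "i \<le> n" for i
      proof (cases "i = ord s \<and> n - i = ord (u - s)")
        case True': True
        then have "fps_nth (a i) s = coeff c s" "fps_nth (b (n - i)) (u - s) = coeff d (u - s)"
          using leading_cosetD(3)[OF a] leading_cosetD(3)[OF b] True by auto
        then show ?thesis using True' u i by auto
      next
        case False
        then have "\<not> (i \<le> ord s \<and> n - i \<le> ord (u - s))" using le i by linarith
        then have "fps_nth (a i) s = 0 \<or> fps_nth (b (n - i)) (u - s) = 0" using a' b' by blast
        then show ?thesis using False u le by auto
      qed
      then have "(\<Sum>i\<le>n. fps_nth (a i) s * fps_nth (b (n - i)) (u - s)) =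
          (\<Sum>i\<le>n. if i = ord s then (if ord s + ord (u - s) = ord u then coeff c s * coeff d (u - s) else 0) else 0)"
        by (intro sum.cong) auto
      also have "\<dots> = (if ord s + ord (u - s) = ord u then coeff c s * coeff d (u - s) else 0)"
        using le by simp
      finally show ?thesis .
    next
      case False
      then have "fps_nth (a i) s = 0 \<or> fps_nth (b (n - i)) (u - s) = 0" for i using a' b' by blast
      moreover have "coeff c s = 0 \<or> coeff d (u - s) = 0" using False c d by (auto simp: carrier_model)
      ultimately show ?thesis by (auto intro!: sum.neutral)
    qed
    have "fps_nth (\<Sum>i\<le>n. a i * b (n - i)) u =
        (\<Sum>i\<le>n. \<Sum>s=0..u. fps_nth (a i) s * fps_nth (b (n - i)) (u - s))"
      by (simp add: fps_sum_nth fps_mult_nth)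
    also have "\<dots> = (\<Sum>s=0..u. \<Sum>i\<le>n. fps_nth (a i) s * fps_nth (b (n - i)) (u - s))"
      by (rule sum.swap)
    also have "\<dots> = coeff (graded_mult c d) u"
      unfolding coeff_graded_mult graded_coeff_def using inner by (intro sum.cong) auto
    finally show ?thesis .
  qed
  ultimately show ?thesis unfolding leading_coset_def by blast
qed

text \<open>All choices of representatives give the same coset, so the union in
  \<open>assoc_graded\<close> collapses; \<open>homogeneous_part\<close> provides one
  choice.\<close>

lemma leading_coset_mult:
  assumes c: "c \<in> carrier graded_model" and d: "d \<in> carrier graded_model"
  shows "leading_coset (graded_mult c d) = leading_coset c \<otimes>\<^bsub>tangent_cone\<^esub> leading_coset d"
proof
  fix n
  have eq: "filt (Suc n) +>\<^bsub>R\<^esub> (\<Oplus>\<^bsub>R\<^esub>i\<in>{..n}. a i \<otimes>\<^bsub>R\<^esub> b (n - i)) = leading_coset (graded_mult c d) n"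
    if "\<And>i. a i \<in> leading_coset c i" "\<And>i. b i \<in> leading_coset d i" for a b
  proof -
    have "a i \<in> carrier R" "b i \<in> carrier R" for i
      using leading_cosetD(1)[OF that(1)[of i]] leading_cosetD(1)[OF that(2)[of i]] filt_antimono[of 0 i]
      by (auto simp: carrier_R)
    then have "(\<Oplus>\<^bsub>R\<^esub>i\<in>{..n}. a i \<otimes>\<^bsub>R\<^esub> b (n - i)) = (\<Sum>i\<le>n. a i * b (n - i))"
      by (subst finsum_R) (auto simp flip: R_simps)
    then show ?thesis using rcoset_filt_eq[OF leading_coset_mult_mem[OF c d that]] by simp
  qed
  have "homogeneous_part c \<in> {a. \<forall>i. a i \<in> leading_coset c i}"
    "homogeneous_part d \<in> {b. \<forall>i. b i \<in> leading_coset d i}"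
    using homogeneous_part_in by auto
  then have "(\<Union>a\<in>{a. \<forall>i. a i \<in> leading_coset c i}. \<Union>b\<in>{b. \<forall>i. b i \<in> leading_coset d i}.
      filt (Suc n) +>\<^bsub>R\<^esub> (\<Oplus>\<^bsub>R\<^esub>i\<in>{..n}. a i \<otimes>\<^bsub>R\<^esub> b (n - i))) = leading_coset (graded_mult c d) n"
    by (intro SUP_eq_const) (auto intro!: SUP_eq_const eq)
  then show "leading_coset (graded_mult c d) n = (leading_coset c \<otimes>\<^bsub>tangent_cone\<^esub> leading_coset d) n"
    by (simp add: tangent_cone_simps)
qed

lemma leading_coset_add: "leading_coset (c + d) = leading_coset c \<oplus>\<^bsub>tangent_cone\<^esub> leading_coset d"
proof
  fix n
  have "leading_coset (c + d) n = leading_coset c n <+>\<^bsub>R\<^esub> leading_coset d n"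
  proof (intro Set.set_eqI iffI)
    fix g assume g: "g \<in> leading_coset (c + d) n"
    let ?h = "homogeneous_part d n"
    have h: "?h \<in> leading_coset d n" by (rule homogeneous_part_in)
    have "g + - ?h \<in> filt n" using g h filt_add filt_uminus unfolding leading_coset_def by blast
    then have "g - ?h \<in> leading_coset c n"
      using leading_cosetD(3)[OF g] leading_cosetD(3)[OF h] by (simp add: leading_coset_def)
    moreover have "g = (g - ?h) \<oplus>\<^bsub>R\<^esub> ?h" by (simp add: R_simps)
    ultimately show "g \<in> leading_coset c n <+>\<^bsub>R\<^esub> leading_coset d n"
      using h unfolding set_add_def' by blast
  next
    fix g assume "g \<in> leading_coset c n <+>\<^bsub>R\<^esub> leading_coset d n"
    then show "g \<in> leading_coset (c + d) n"
      unfolding set_add_def' by (auto simp: leading_coset_def R_simps filt_add)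
  qed
  then show "leading_coset (c + d) n = (leading_coset c \<oplus>\<^bsub>tangent_cone\<^esub> leading_coset d) n"
    by (simp add: tangent_cone_simps)
qed

lemma leading_coset_one: "leading_coset 1 = \<one>\<^bsub>tangent_cone\<^esub>"
proof
  fix n
  have neq: "s \<noteq> 0" if "ord s > 0" for s using that ord_zero by (metis less_irrefl)
  have "(if n = 0 then \<one>\<^bsub>R\<^esub> else \<zero>\<^bsub>R\<^esub>) \<in> leading_coset 1 n"
    using filt_one filt_zero ord_zero ord_pos neq by (auto simp: leading_coset_def R_simps)
  then show "leading_coset 1 n = \<one>\<^bsub>tangent_cone\<^esub> n"
    using rcoset_filt_eq by (simp add: tangent_cone_simps)
qed

lemma inj_leading_coset: "inj_on leading_coset (carrier graded_model)"
proof (rule inj_onI)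
  fix c d assume c: "c \<in> carrier graded_model" and d: "d \<in> carrier graded_model"
    and eq: "leading_coset c = leading_coset d"
  show "c = d"
  proof (rule poly_eqI)
    fix s
    show "coeff c s = coeff d s"
    proof (cases "s \<in> \<Gamma>")
      case True
      have "homogeneous_part c (ord s) \<in> leading_coset d (ord s)"
        using homogeneous_part_in[of c] eq by metis
      then show ?thesis using True by (auto simp: leading_coset_def homogeneous_part_def)
    next
      case False
      then have "coeff c s = 0" "coeff d s = 0" using c d by (auto simp: carrier_model)
      then show ?thesis by simp
    qed
  qed
qed

text \<open>The coefficient at \<open>s\<close> is read off from a representative of the component
  of degree \<open>ord s\<close>.\<close>

lemma leading_coset_surj:
  assumes f: "f \<in> carrier tangent_cone"
  shows "\<exists>c\<in>carrier graded_model. f = leading_coset c"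
proof -
  have "\<exists>x\<in>filt n. f n = filt (Suc n) +>\<^bsub>R\<^esub> x" for n using f by (auto simp: tangent_cone_simps)
  then obtain x where x: "\<And>n. x n \<in> filt n" "\<And>n. f n = filt (Suc n) +>\<^bsub>R\<^esub> x n" by metis
  define q where "q s = (if s \<in> \<Gamma> then fps_nth (x (ord s)) s else 0)" for s
  have "{s. q s \<noteq> 0} \<subseteq> (\<Union>n\<in>{n. f n \<noteq> filt (Suc n)}. {s \<in> \<Gamma>. ord s = n})"
  proof
    fix s assume "s \<in> {s. q s \<noteq> 0}"
    then have s: "s \<in> \<Gamma>" "fps_nth (x (ord s)) s \<noteq> 0" by (auto simp: q_def split: if_splits)
    have "x (ord s) \<in> f (ord s)" unfolding x(2) rcoset_R using filt_zero by force
    moreover have "x (ord s) \<notin> filt (Suc (ord s))" using s by (auto simp: filt_def)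
    ultimately show "s \<in> (\<Union>n\<in>{n. f n \<noteq> filt (Suc n)}. {s \<in> \<Gamma>. ord s = n})" using s(1) by auto
  qed
  moreover have "finite (\<Union>n\<in>{n. f n \<noteq> filt (Suc n)}. {s \<in> \<Gamma>. ord s = n})"
    using f finite_ord_fibre by (intro finite_UN_I) (auto simp: tangent_cone_simps)
  ultimately have "finite {s. q s \<noteq> 0}" by (rule finite_subset)
  then have q: "coeff (Abs_poly q) = q" by (intro Abs_poly_inverse) (auto simp: eventually_cofinite)
  have "Abs_poly q \<in> carrier graded_model" by (simp add: carrier_model q) (simp add: q_def)
  moreover have "f = leading_coset (Abs_poly q)"
  proof
    fix n
    have "x n \<in> leading_coset (Abs_poly q) n" using x(1) by (auto simp: leading_coset_def q q_def)
    then show "f n = leading_coset (Abs_poly q) n" unfolding x(2) by (rule rcoset_filt_eq)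
  qed
  ultimately show ?thesis by blast
qed

lemma leading_coset_iso: "leading_coset \<in> ring_iso graded_model tangent_cone"
proof (rule ring_iso_memI)
  show "bij_betw leading_coset (carrier graded_model) (carrier tangent_cone)"
    unfolding bij_betw_def using inj_leading_coset leading_coset_closed leading_coset_surj by blast
qed (auto simp: graded_model_simps leading_coset_closed leading_coset_mult leading_coset_add leading_coset_one)

lemma leading_coset_model_zero: "leading_coset \<zero>\<^bsub>graded_model\<^esub> = \<zero>\<^bsub>tangent_cone\<^esub>"
  by (auto simp: graded_model_simps leading_coset_zero tangent_cone_simps)

section \<open>Structure over \<open>K[X]\<close> when adding \<open>m\<close> raises orders by
  exactly one\<close>

context
  fixes m
  assumes m: "m \<in> set ms" and ord_step: "\<And>s. s \<in> \<Gamma> \<Longrightarrow> ord (s + m) = ord s + 1"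
begin

lemma m_pos: "m > 0"
  using m pos by auto

lemma \<Gamma>_add_multiple: "s \<in> \<Gamma> \<Longrightarrow> s + k * m \<in> \<Gamma>"
proof (induction k)
  case (Suc k)
  then have "(s + k * m) + m \<in> \<Gamma>" using \<Gamma>_add[OF _ generator_\<Gamma>(1)[OF m]] by blast
  then show ?case by (simp add: ac_simps)
qed simp

lemma ord_add_multiple: "s \<in> \<Gamma> \<Longrightarrow> ord (s + k * m) = ord s + k"
proof (induction k)
  case (Suc k)
  have eq: "s + Suc k * m = (s + k * m) + m" by simp
  show ?case unfolding eq using ord_step[OF \<Gamma>_add_multiple[OF Suc.prems, of k]] Suc by simp
qed simp

text \<open>The structure map from \<open>K[X]\<close> sends \<open>X\<close> to \<open>e_m\<close>.
  \<open>K[X]\<close> has the same underlying type as the model, but carries the usual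
  product.\<close>

abbreviation subst_power :: "'k poly \<Rightarrow> 'k poly" where
  "subst_power p \<equiv> pcompose p (monom 1 m)"

lemma coeff_subst_power: "coeff (subst_power p) i \<noteq> 0 \<Longrightarrow> m dvd i"
proof (induction p arbitrary: i)
  case (pCons a p)
  show ?case
  proof (cases "i = 0")
    case False
    then have "coeff (subst_power (pCons a p)) i = (if m \<le> i then coeff (subst_power p) (i - m) else 0)"
      by (simp add: pcompose_pCons coeff_monom_mult coeff_pCons split: nat.splits)
    then have "m \<le> i" "coeff (subst_power p) (i - m) \<noteq> 0" using pCons.prems by (metis, metis)
    then have "m \<le> i" "m dvd i - m" by (blast intro: pCons.IH)+
    then show ?thesis by (metis dvd_diffD dvd_refl)
  qed simp
qed simp

lemma subst_power_closed: "subst_power p \<in> carrier graded_model"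
  unfolding carrier_model
proof (intro allI impI)
  fix s assume "coeff (subst_power p) s \<noteq> 0"
  then obtain k where "s = m * k" using coeff_subst_power by (metis dvdE)
  then show "s \<in> \<Gamma>" using \<Gamma>_add_multiple[OF zero_\<Gamma>, of k] by (simp add: mult.commute)
qed

text \<open>Multiplying by \<open>t\<^sup>m\<close> raises orders by exactly one, so that no product vanishes.\<close>

lemma graded_mult_subst_power:
  assumes c: "c \<in> carrier graded_model"
  shows "graded_mult (subst_power p) c = subst_power p * c"
proof (rule poly_eqI)
  fix u
  have "(if ord i + ord (u - i) = ord u then coeff (subst_power p) i * coeff c (u - i) else 0) =
      coeff (subst_power p) i * coeff c (u - i)" if i: "i \<le> u" for i
  proof (cases "coeff (subst_power p) i * coeff c (u - i) = 0")
    case False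
    then have "m dvd i" and G: "u - i \<in> \<Gamma>" using coeff_subst_power[of p i] c by (auto simp: carrier_model)
    then obtain k where k: "i = k * m" by (metis dvdE mult.commute)
    have "ord i = k" using ord_add_multiple[OF zero_\<Gamma>, of k] k ord_zero by simp
    moreover have "ord u = ord (u - i) + k" using ord_add_multiple[OF G, of k] i k by simp
    ultimately show ?thesis by simp
  qed auto
  then show "coeff (graded_mult (subst_power p) c) u = coeff (subst_power p * c) u"
    unfolding coeff_graded_mult graded_coeff_def coeff_mult atMost_atLeast0 by (intro sum.cong) auto
qed

definition apery where "apery = {w \<in> \<Gamma>. \<not> (m \<le> w \<and> w - m \<in> \<Gamma>)}"

text \<open>Its elements are distinct modulo \<open>m\<close>: the larger of two congruent ones
  would stay in \<open>\<Gamma>\<close> after subtracting \<open>m\<close>.\<close>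

lemma finite_apery: "finite apery"
proof (rule inj_on_finite)
  have no: False if "w \<in> \<Gamma>" "w' \<in> apery" and mod: "w mod m = w' mod m" and less: "w < w'" for w w'
  proof -
    obtain k where k: "w' = w + m * k"
      using mod_eq_nat1E[OF mod[symmetric] less_imp_le[OF less]] .
    then obtain j where j: "k = Suc j" using less by (cases k) auto
    then have "m \<le> w'" "w' - m = w + j * m" using k by (auto simp: mult.commute)
    then show False using that(2) \<Gamma>_add_multiple[OF that(1), of j] by (simp add: apery_def)
  qed
  show "inj_on (\<lambda>w. w mod m) apery"
  proof (rule inj_onI)
    fix w w' assume "w \<in> apery" "w' \<in> apery" "w mod m = w' mod m"
    then show "w = w'" using no[of w w'] no[of w' w] by (cases w w' rule: linorder_cases) (auto simp: apery_def)
  qed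
  show "(\<lambda>w. w mod m) ` apery \<subseteq> {..<m}" using m_pos by auto
qed simp

text \<open>By \<open>graded_mult_subst_power\<close> the action of \<open>K[X]\<close> is ordinary
  multiplication of polynomials, so it is torsion-free. Subtracting \<open>m\<close> repeatedly
  leads from any \<open>s\<close> in \<open>\<Gamma>\<close> to the Apery set, whose monomials
  therefore generate.\<close>

lemma finite_torsion_free_model:
  "finite_torsion_free_algebra graded_model subst_power (monom 1 ` apery)"
proof (intro finite_torsion_free_algebra.intro[OF cring_model] finite_torsion_free_algebra_axioms.intro)
  show "subst_power (p * q) = subst_power p \<otimes>\<^bsub>graded_model\<^esub> subst_power q" for p q
    by (simp add: graded_model_simps graded_mult_subst_power subst_power_closed pcompose_mult)
  show "monom 1 ` apery \<subseteq> carrier graded_model"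
    by (auto simp: carrier_model apery_def split: if_splits)
  fix g p assume g: "g \<in> carrier graded_model" "subst_power p \<otimes>\<^bsub>graded_model\<^esub> g = \<zero>\<^bsub>graded_model\<^esub>" "p \<noteq> 0"
  have "subst_power p \<noteq> 0"
    using g(3) m_pos by (subst pcompose_eq_0_iff) (auto simp: degree_monom_eq)
  then show "g = \<zero>\<^bsub>graded_model\<^esub>"
    using g by (simp add: graded_model_simps graded_mult_subst_power)
next
  fix S g assume S: "monom 1 ` apery \<subseteq> S" "\<zero>\<^bsub>graded_model\<^esub> \<in> S"
    "\<And>a b. a \<in> S \<Longrightarrow> b \<in> S \<Longrightarrow> a \<oplus>\<^bsub>graded_model\<^esub> b \<in> S"
    "\<And>p a. a \<in> S \<Longrightarrow> subst_power p \<otimes>\<^bsub>graded_model\<^esub> a \<in> S" and g: "g \<in> carrier graded_model"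
  have monom_closed: "monom a s \<in> carrier graded_model" if "s \<in> \<Gamma>" for a s
    using that by (auto simp: carrier_model split: if_splits)
  have monom_S: "monom a s \<in> S" if "s \<in> \<Gamma>" for a s
    using that
  proof (induction s rule: less_induct)
    case (less s)
    show ?case
    proof (cases "s \<in> apery")
      case True
      \<comment> \<open>The coefficient is supplied by the action of a constant polynomial.\<close>
      then have "subst_power [:a:] \<otimes>\<^bsub>graded_model\<^esub> monom 1 s \<in> S" using S(1,4) by blast
      then show ?thesis
        using less.prems by (simp add: graded_model_simps graded_mult_subst_power monom_closed smult_monom del: pcompose_const)
          (simp add: smult_monom)
    next
      case False
      then have s: "m \<le> s" "s - m \<in> \<Gamma>" using less.prems by (auto simp: apery_def)
      then have "subst_power [:0, 1:] \<otimes>\<^bsub>graded_model\<^esub> monom a (s - m) \<in> S"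
        using less.IH[of "s - m"] m_pos by (intro S(4)) auto
      moreover have "subst_power [:0, 1:] = monom 1 m" by (simp add: pcompose_pCons)
      ultimately show ?thesis
        using s graded_mult_subst_power[OF monom_closed[OF s(2), of a], of "[:0, 1:]"]
        by (simp add: graded_model_simps mult_monom)
    qed
  qed
  have "(\<Sum>i\<in>A. monom (coeff g i) i) \<in> S" if "finite A" for A
    using that
  proof (induction A rule: finite_induct)
    case (insert i A)
    have "monom (coeff g i) i \<in> S"
      using monom_S[of i "coeff g i"] g S(2) by (cases "coeff g i = 0") (auto simp: carrier_model graded_model_simps)
    then show ?case using insert S(3) by (simp add: graded_model_simps)
  qed (use S(2) in \<open>simp add: graded_model_simps\<close>)
  from this[of "{..degree g}"] show "g \<in> S" by (simp add: poly_as_sum_of_monoms)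
next
  show "\<exists>x::'k poly. x \<noteq> 0 \<and> \<not> x dvd 1"
    by (rule exI[of _ "[:0, 1:]"]) (auto simp: is_unit_poly_iff)
qed (use finite_apery subst_power_closed in \<open>auto simp: graded_model_simps pcompose_add pcompose_1\<close>)

theorem cohen_macaulay_tangent_cone: "cohen_macaulay tangent_cone"
proof -
  interpret T: finite_torsion_free_algebra tangent_cone "leading_coset \<circ> subst_power" "leading_coset ` monom 1 ` apery"
    by (rule finite_torsion_free_algebra_iso[OF finite_torsion_free_model leading_coset_iso leading_coset_model_zero])
  show ?thesis by (rule T.cohen_macaulay)
qed

end
end

section \<open>Factorizations in the semigroup\<close>

text \<open>Here \<open>q = 2h - 1\<close>, which keeps subtraction out of the generators.\<close>

definition wt :: "nat \<Rightarrow> nat \<Rightarrow> nat \<Rightarrow> nat \<Rightarrow> nat \<Rightarrow> nat" where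
  "wt q a b c d = a * ((q + 1) * q) + b * ((q + 2) * q) + c * ((q + 1) * (q + 2)) + d * ((q + 1) * (q + 2) + q)"

lemma wt_Suc: "wt q (Suc a) b c d = wt q a b c d + (q + 1) * q"
  by (simp add: wt_def)

text \<open>With \<open>p = q + 1\<close> the conditions say that no factor \<open>x_1 x_2\<close>,
  no \<open>x_1^j x_3^k\<close> with \<open>j + k = p\<close> and no \<open>x_2^j x_3^k\<close> with
  \<open>j + k = p - 1\<close> occurs.\<close>

definition reduced :: "nat \<Rightarrow> nat \<Rightarrow> nat \<Rightarrow> nat \<Rightarrow> bool" where
  "reduced q b c d \<longleftrightarrow> (b = 0 \<or> c = 0) \<and> b + d \<le> q \<and> c + d < q"

text \<open>The relation \<open>x_1^j x_3^k = x_0^(j+1) x_2^k\<close>, which lengthens a monomial by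
  one.\<close>

lemma binomial_relation_13:
  assumes "j + k = q + 1"
  shows "wt q a (b + j) c (d + k) = wt q (a + (j + 1)) b (c + k) d"
proof -
  \<comment> \<open>Eliminating \<open>q\<close>, over the integers because of the subtraction,
    leaves a polynomial identity in the remaining variables.\<close>
  have q: "int q = int j + int k - 1" using assms by linarith
  have "int (wt q a (b + j) c (d + k)) = int (wt q (a + (j + 1)) b (c + k) d)"
    unfolding wt_def of_nat_add of_nat_mult q by (simp add: algebra_simps)
  then show ?thesis by linarith
qed

text \<open>The relation \<open>x_2^j x_3^k = x_0^(j+2) x_1^k\<close>, which lengthens a monomial by
  two.\<close>

lemma binomial_relation_23:
  assumes "j + k = q"
  shows "wt q a b (c + j) (d + k) = wt q (a + (j + 2)) (b + k) c d"
  using assms by (auto simp: wt_def algebra_simps)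

lemma binomial_relation_12: "wt q a (b + 1) (c + 1) d = wt q (a + 1) b c (d + 1)"
  by (simp add: wt_def algebra_simps)

text \<open>Either \<open>x_0\<close> is present already, or some relation applies; its right-hand
  side contains \<open>x_0\<close> and has at least as many factors as its left-hand side.\<close>

lemma reduction_step:
  assumes "\<not> (a = 0 \<and> reduced q b c d)"
  obtains a' b' c' d' where "wt q a b c d = wt q (Suc a') b' c' d'" "a + b + c + d \<le> Suc a' + b' + c' + d'"
proof -
  consider "a > 0" | "b > 0" "c > 0" | "b + d > q" | "c + d \<ge> q"
    using assms by (fastforce simp: reduced_def)
  then show thesis
  proof cases
    case 1
    then show thesis using that[of "a - 1" b c d] by simp
  next
    case 2
    then show thesis using that[of a "b - 1" "c - 1" "d + 1"] binomial_relation_12[of q a "b - 1" "c - 1" d] by simp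
  next
    case 3
    \<comment> \<open>Use as many factors \<open>x_3\<close> as the relation admits;
      \<open>b + d > q\<close> guarantees that enough factors \<open>x_1\<close> are left for the
      rest.\<close>
    define k where "k = min d (q + 1)"
    define j where "j = q + 1 - k"
    have jk: "j + k = q + 1" "j \<le> b" "k \<le> d" using 3 by (auto simp: j_def k_def)
    then show thesis
      using that[of "a + j" "b - j" "c + k" "d - k"] binomial_relation_13[OF jk(1), of a "b - j" c "d - k"] by simp
  next
    case 4
    define k where "k = min d q"
    define j where "j = q - k"
    have jk: "j + k = q" "j \<le> c" "k \<le> d" using 4 by (auto simp: j_def k_def)
    then show thesis
      using that[of "a + j + 1" "b + k" "c - j" "d - k"] binomial_relation_23[OF jk(1), of a b "c - j" "d - k"] by simp
  qed
qed

text \<open>Induction on the weight: a reduction step exposes an \<open>x_0\<close>, and what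
  remains after removing it is lighter.\<close>

lemma reduce:
  assumes "q > 0"
  shows "\<exists>k b' c' d'. wt q a b c d = wt q k b' c' d' \<and> reduced q b' c' d'"
proof (induction "wt q a b c d" arbitrary: a b c d rule: less_induct)
  case less
  show ?case
  proof (cases "a = 0 \<and> reduced q b c d")
    case False
    then obtain a' b' c' d' where *: "wt q a b c d = wt q (Suc a') b' c' d'"
      by (rule reduction_step)
    then have "wt q a' b' c' d' < wt q a b c d" using assms by (simp add: wt_def)
    then obtain k b'' c'' d'' where "wt q a' b' c' d' = wt q k b'' c'' d''" "reduced q b'' c'' d''"
      using less by blast
    then have "wt q a b c d = wt q (Suc k) b'' c'' d'' \<and> reduced q b'' c'' d''"
      using * by (simp add: wt_def)
    then show ?thesis by blast
  qed blast
qed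

section \<open>Uniqueness of reduced exponent vectors\<close>

lemma dvd_diff_small:
  fixes x y n :: nat
  assumes "int n dvd int x - int y" "x < n" "y < n"
  shows "x = y"
proof -
  have "int x mod int n = int y mod int n" using assms(1) by (simp add: mod_eq_dvd_iff)
  then have "x mod n = y mod n" by (simp flip: of_nat_mod)
  then show ?thesis using assms(2,3) by simp
qed

text \<open>A reduced exponent vector is determined by its weight modulo \<open>q + 1\<close> and modulo \<open>q\<close>, which
  give \<open>b + d\<close> and, \<open>q\<close> being odd, \<open>c + d\<close>.\<close>

lemma reduced_unique:
  assumes "odd q" "reduced q b c d" "reduced q b' c' d'" "wt q 0 b c d = wt q k b' c' d'"
  shows "k = 0"
proof -
  define Q where "Q = int q"
  have eq: "int (wt q 0 b c d) = int (wt q k b' c' d')" using assms by simp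
  \<comment> \<open>Modulo \<open>q + 1\<close> the generators \<open>m1\<close> and
    \<open>m3\<close> are both \<open>-1\<close>, while \<open>m0\<close> and \<open>m2\<close>
    vanish.\<close>
  have "(int b + int d) - (int b' + int d') =
      (Q + 1) * ((int b - int b') * (Q + 1) + (int c - int c') * (Q + 2) + (int d - int d') * (Q + 3) - int k * Q)"
    using eq by (simp add: wt_def algebra_simps flip: Q_def)
  then have "Q + 1 dvd (int b + int d) - (int b' + int d')" by (rule dvdI)
  then have "int (q + 1) dvd int (b + d) - int (b' + d')" by (simp add: Q_def add.commute)
  then have bd: "b + d = b' + d'"
    by (rule dvd_diff_small) (use assms in \<open>auto simp: reduced_def\<close>)
  \<comment> \<open>Modulo \<open>q\<close> the generators \<open>m2\<close> and \<open>m3\<close>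
    are both \<open>2\<close>, while \<open>m0\<close> and \<open>m1\<close> vanish.\<close>
  have "2 * ((int c + int d) - (int c' + int d')) =
      Q * (int k * (Q + 1) - (int b - int b') * (Q + 2) - (int c - int c') * (Q + 3) - (int d - int d') * (Q + 4))"
    using eq by (simp add: wt_def algebra_simps flip: Q_def)
  then have "Q dvd 2 * ((int c + int d) - (int c' + int d'))" by (rule dvdI)
  then have "int q dvd 2 * (int (c + d) - int (c' + d'))" by (simp add: Q_def)
  moreover have "coprime (int q) 2" using assms(1) by simp
  ultimately have "int q dvd int (c + d) - int (c' + d')"
    using coprime_dvd_mult_right_iff by blast
  then have cd: "c + d = c' + d'"
    by (rule dvd_diff_small) (use assms in \<open>auto simp: reduced_def\<close>)
  \<comment> \<open>The two sums determine the difference of \<open>b\<close> and \<open>c\<close>,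
    and as one of these is zero, they determine both.\<close>
  have "b = b'" "c = c'" "d = d'" using bd cd assms(2,3) by (auto simp: reduced_def)
  then show ?thesis using assms(1,4) by (auto simp: wt_def)
qed

text \<open>A factorization of \<open>s + m0\<close> can be rewritten, without shortening, so that
  \<open>x_0\<close> occurs, and then one \<open>x_0\<close> is removed. The exception would be a
  reduced one without \<open>x_0\<close>; but \<open>s + m0\<close> also has a reduced form with a
  positive power of \<open>x_0\<close>, against \<open>reduced_unique\<close>.\<close>

lemma remove_first_generator:
  assumes "odd q" and eq: "wt q a b c d = wt q (Suc u) v w z"
  obtains a' b' c' d' where "wt q a' b' c' d' = wt q u v w z" "a + b + c + d \<le> Suc (a' + b' + c' + d')"
proof (cases "a = 0 \<and> reduced q b c d")
  case True
  have q: "q > 0" using assms(1) by (rule odd_pos)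
  obtain k b' c' d' where "wt q (Suc u) v w z = wt q (Suc k) b' c' d'" "reduced q b' c' d'"
    using reduce[OF q, of u v w z] by (auto simp: wt_Suc)
  then show thesis using reduced_unique[OF assms(1), of b c d b' c' d' "Suc k"] True eq by auto
next
  case False
  then obtain a' b' c' d' where "wt q a b c d = wt q (Suc a') b' c' d'" "a + b + c + d \<le> Suc a' + b' + c' + d'"
    by (rule reduction_step)
  then show thesis using that[of a' b' c' d'] eq by (simp add: wt_def)
qed

theorem corollary3p7:
  fixes h m0 m1 m2 m3 :: nat
    and R :: "'k::field fps ring"
    and \<mm> :: "'k fps set"
  assumes "h \<ge> 2"
    and "m0 = 2 * h * (2 * h - 1)"
    and "m1 = (2 * h + 1) * (2 * h - 1)"
    and "m2 = 2 * h * (2 * h + 1)"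
    and "m3 = 2 * h * (2 * h + 1) + (2 * h - 1)"
    and "R = monomial_series_ring [m0, m1, m2, m3]"
    and "maximalideal \<mm> R"
  shows "cohen_macaulay (assoc_graded R \<mm>)"
proof -
  let ?ms = "[m0, m1, m2, m3]"
  define q where "q = 2 * h - 1"
  have q: "odd q" "2 * h = q + 1" using assms(1) by (auto simp: q_def)
  have m_eq: "m0 = (q + 1) * q" "m1 = (q + 2) * q" "m2 = (q + 1) * (q + 2)" "m3 = (q + 1) * (q + 2) + q"
    unfolding assms(2-5) q_def[symmetric] q(2) by simp_all
  interpret monomial_ring ?ms R
    using q assms(6) by unfold_locales (auto simp: m_eq odd_pos)
  have weight: "weight ?ms [a, b, c, d] = wt q a b c d" for a b c d
    by (simp add: weight_def wt_def m_eq lessThan_Suc numeral_nat)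
  have deg: "deg [a, b, c, d] = a + b + c + d" for a b c d
    by (simp add: deg_def lessThan_Suc numeral_nat)
  have factorization: "x \<in> factorizations s \<longleftrightarrow> (\<exists>a b c d. x = [a, b, c, d] \<and> wt q a b c d = s)" for x s
  proof -
    have "length x = length ?ms \<longleftrightarrow> (\<exists>a b c d. x = [a, b, c, d])"
      by (auto simp: length_Suc_conv)
    then show ?thesis unfolding factorizations_def using weight by auto
  qed
  have "ord (s + m0) = ord s + 1" if s: "s \<in> \<Gamma>" for s
  proof (rule antisym)
    show "ord s + 1 \<le> ord (s + m0)"
      using ord_superadditive[OF s generator_\<Gamma>(1)[of m0]] generator_\<Gamma>(2)[of m0] by simp
    \<comment> \<open>For the other inequality a longest factorization of \<open>s + m0\<close> is
      turned into one of \<open>s\<close> that is shorter by at most one.\<close>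
    have s': "s + m0 \<in> \<Gamma>" using \<Gamma>_add[OF s generator_\<Gamma>(1)[of m0]] by simp
    obtain a b c d where x: "wt q a b c d = s + m0" "a + b + c + d = ord (s + m0)"
      using ord_attained[OF s'] by (auto simp: factorization deg)
    obtain u v w z where u: "wt q u v w z = s" using s factorization unfolding in_\<Gamma>_iff by blast
    have "wt q a b c d = wt q (Suc u) v w z" using x(1) u by (simp add: wt_Suc m_eq)
    then obtain a' b' c' d' where y: "wt q a' b' c' d' = s" "a + b + c + d \<le> Suc (a' + b' + c' + d')"
      using remove_first_generator[OF q(1)] u by metis
    have "deg [a', b', c', d'] \<le> ord s" using y(1) by (intro deg_le_ord) (auto simp: factorization)
    then show "ord (s + m0) \<le> ord s + 1" using x(2) y(2) by (simp add: deg)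
  qed
  then have "cohen_macaulay tangent_cone" by (intro cohen_macaulay_tangent_cone[of m0]) auto
  then show ?thesis
    using maximalideal_R[OF assms(7)] by (simp add: tangent_cone_def)
qed

end
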